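(* Let $(\tau,s)\in\mathcal{D}$ and assume that all subdifferentials $\partial f_i$ ($i=1,\dots,p$) and $\partial g_j$ ($j=1,\dots,q$) are piecewise linear multifunctions. Let $\{\mathbf{w}^k\}$ be generated by GS-ADMM. Then there exists a constant $\zeta>0$ such that, for all $k\ge 0$, $$\mathrm{dist}^2_{H}(\mathbf{w}^{k+1},\mathcal{M}^* )\leq\frac{1}{1+\epsilon}\,\mathrm{dist}^2_{H}(\mathbf{w}^k,\mathcal{M}^* ),$$ where $$\epsilon=\frac{\lambda_{\min}(G)}{\zeta^2\max_{i,j}\{\delta\widetilde{\mu}_i,\delta\widetilde{\nu}_j,\delta\}\,\lambda_{\max}(H)}>0,$$ the maximum being over $i=1,\dots,p$ and $j=1,\dots,q$.
   Context: Problem. Let $p,q\ge 1$ be integers. Consider $$\min \sum_{i=1}^{p}f_i(x_i)+ \sum_{j=1}^{q}g_j(y_j)\quad \text{s.t. } \sum_{i=1}^{p}A_i x_i+\sum_{j=1}^{q}B_jy_j=c,\ x_i\in \mathcal{X}_i\ (i=1,\dots,p),\ y_j\in \mathcal{Y}_j\ (j=1,\dots,q),$$ where $f_i:\mathbb{R}^{m_i}\to\mathbb{R}$, $g_j:\mathbb{R}^{d_j}\to\mathbb{R}$ are closed proper convex functions (possibly nonsmooth), $A_i\in\mathbb{R}^{n\times m_i}$, $B_j\in\mathbb{R}^{n\times d_j}$, $c\in\mathbb{R}^n$, and $\mathcal{X}_i\subset\mathbb{R}^{m_i}$, $\mathcal{Y}_j\subset\mathbb{R}^{d_j}$ are polyhedra.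 Standing assumptions: the solution set of this problem is nonempty and all $A_i$, $B_j$ have full column rank. A multifunction $\phi$ is piecewise linear if its graph $\{(x,y)\mid y\in\phi(x)\}$ is a union of finitely many polyhedra. Notation. $\mathcal{A}=[A_1,\dots,A_p]$, $\mathcal{B}=[B_1,\dots,B_q]$, $\mathbf{x}=(x_1,\dots,x_p)$, $\mathbf{y}=(y_1,\dots,y_q)$, $\mathbf{u}=(\mathbf{x},\mathbf{y})$, $\mathbf{w}=(\mathbf{x},\mathbf{y},\lambda)$ with $\lambda\in\mathbb{R}^n$. $\mathcal{X}=\mathcal{X}_1\times\cdots\times\mathcal{X}_p$, $\mathcal{Y}=\mathcal{Y}_1\times\cdots\times\mathcal{Y}_q$, $\mathcal{M}=\mathcal{X}\times\mathcal{Y}\times\mathbb{R}^n$. $\|\cdot\|$ is the Euclidean norm; $\|x\|_G^2=x^{\sf T}Gx$ for symmetric $G$; $\lambda_{\max},\lambda_{\min}$ are the largest and smallest eigenvalues. For $\beta>0$, $$\mathcal{L}_\beta(\mathbf{x},\mathbf{y},\lambda)=\sum_{i}f_i(x_i)+\sum_j g_j(y_j)-\langle\lambda,\mathcal{A}\mathbf{x}+\mathcal{B}\mathbf{y}-c\rangle+\frac{\beta}{2}\|\mathcal{A}\mathbf{x}+\mathcal{B}\mathbf{y}-c\|^2 .$$ GS-ADMM. Parameters: $\beta>0$, $\sigma_1\in(p-1,+\infty)$, $\sigma_2\in(q-1,+\infty)$, and stepsizes $(\tau,s)\in\mathcal{D}:=\{(\tau,s)\mid \tau<1,\ s<1,\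 \tau+s>0\}$. From an initial point $\mathbf{w}^0=(\mathbf{x}^0,\mathbf{y}^0,\lambda^0)$, for $k=0,1,2,\dots$: - $x_i^{k+1}=\arg\min_{x_i\in\mathcal{X}_i}\mathcal{L}_\beta(x_1^k,\dots,x_i,\dots,x_p^k,\mathbf{y}^k,\lambda^k)+\frac{\sigma_1\beta}{2}\|A_i(x_i-x_i^k)\|^2$, for $i=1,\dots,p$; - $\lambda^{k+\frac12}=\lambda^k-\tau\beta(\mathcal{A}\mathbf{x}^{k+1}+\mathcal{B}\mathbf{y}^k-c)$; - $y_j^{k+1}=\arg\min_{y_j\in\mathcal{Y}_j}\mathcal{L}_\beta(\mathbf{x}^{k+1},y_1^k,\dots,y_j,\dots,y_q^k,\lambda^{k+\frac12})+\frac{\sigma_2\beta}{2}\|B_j(y_j-y_j^k)\|^2$, for $j=1,\dots,q$; - $\lambda^{k+1}=\lambda^{k+\frac12}-s\beta(\mathcal{A}\mathbf{x}^{k+1}+\mathcal{B}\mathbf{y}^{k+1}-c)$. Put $\mathbf{w}^k=(\mathbf{x}^k,\mathbf{y}^k,\lambda^k)$. Matrices. $H_{\mathbf{x}}$ is the $p\times p$ block matrix with diagonal blocks $\sigma_1\beta A_i^{\sf T}A_i$ and off-diagonal $(i,l)$ blocks $-\beta A_i^{\sf T}A_l$. With $D_B=\mathrm{diag}(B_1^{\sf T}B_1,\dots,B_q^{\sf T}B_q)$ (block diagonal), $$Q=\begin{bmatrix}H_{\mathbf{x}}&\mathbf{0}&\mathbf{0}\\ \mathbf{0}&(\sigma_2+1)\beta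 D_B&-\tau\mathcal{B}^{\sf T}\\ \mathbf{0}&-\mathcal{B}&\frac1\beta I\end{bmatrix},\qquad M=\begin{bmatrix}I&\mathbf{0}&\mathbf{0}\\ \mathbf{0}&I&\mathbf{0}\\ \mathbf{0}&-s\beta\mathcal{B}&(\tau+s)I\end{bmatrix},$$ the blocks corresponding to $\mathbf{x},\mathbf{y},\lambda$; $H=QM^{-1}$ and $G=Q+Q^{\sf T}-M^{\sf T}Q$ (both symmetric positive definite for $(\tau,s)\in\mathcal{D}$). Solution set and distance. With $h(\mathbf{u})=\sum_{i=1}^p f_i(x_i)+\sum_{j=1}^q g_j(y_j)$ and $\mathcal{J}(\mathbf{w})=(-\mathcal{A}^{\sf T}\lambda,\,-\mathcal{B}^{\sf T}\lambda,\,\mathcal{A}\mathbf{x}+\mathcal{B}\mathbf{y}-c)$, $$\mathcal{M}^*=\bigcap_{\mathbf{w}\in\mathcal{M}}\{\widehat{\mathbf{w}}\in\mathcal{M}\mid h(\mathbf{u})-h(\widehat{\mathbf{u}})+\langle\mathbf{w}-\widehat{\mathbf{w}},\mathcal{J}(\mathbf{w})\rangle\ge 0\},$$ and $\mathrm{dist}^2_H(\mathbf{w},\mathcal{M}^* )=\min\{\|\mathbf{w}-\mathbf{w}^*\|_H^2\mid\mathbf{w}^*\in\mathcal{M}^*\}$. Constants. $\widetilde\mu_i=\lambda_{\max}(A_i^{\sf T}A_i)$, $\widetilde\nu_j=\lambda_{\max}(B_j^{\sf T}B_j)$, and $\delta=\max\{\overline\theta_i,\overline\vartheta_j,\overline\eta\mid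 i=1,\dots,p,\ j=1,\dots,q\}$, where $$\overline\theta_i=4p(1-\sigma_1)^2\beta^2\sum_{l=1}^p\widetilde\mu_l+4\beta^2\widetilde\mu_i,$$ $$\overline\vartheta_j=4q(s\beta)^2\sum_{l=1}^p\widetilde\mu_l+3q(s\beta)^2\sum_{l=1}^q\widetilde\nu_l+3(\sigma_2+1)^2\beta^2\widetilde\nu_j+2q,$$ $$\overline\eta=4(\tau+s-1)^2\sum_{l=1}^p\widetilde\mu_l+3(s-1)^2\sum_{l=1}^q\widetilde\nu_l+\frac{2}{\beta^2}.$$ *)

theory Defs
  imports "HOL-Analysis.Analysis"
begin

text \<open>
  Block vectors with blocks of different sizes.  The stacked vector
  \<open>x = (x_1, ..., x_p)\<close> of \<open>R^{m_1} \<times> ... \<times> R^{m_p}\<close> is a single vector of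
  type \<open>real ^ 'm\<close>, where the finite type \<open>'m\<close> indexes all \<open>m_1 + ... + m_p\<close> coordinates
  and a map \<open>b :: 'm \<Rightarrow> 'p\<close> assigns to each coordinate the block it belongs to; so \<open>p\<close> is
  \<open>CARD('p)\<close> and \<open>m_i\<close> is \<open>card {k. b k = i}\<close>.  Surjective maps \<open>b\<close> yield exactly the
  tuples of block sizes \<open>m_i \<ge> 1\<close>.  The factor \<open>R^{m_i}\<close> is the coordinate subspace
  \<open>block_space b i\<close>, and \<open>x_i\<close> is the coordinate projection \<open>block b i x\<close>.
\<close>

definition block_space :: "('m::finite \<Rightarrow> 'p) \<Rightarrow> 'p \<Rightarrow> (real ^ 'm) set" where
  "block_space b i = {x. \<forall>k. b k \<noteq> i \<longrightarrow> x $ k = 0}"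

definition block_dim :: "('m::finite \<Rightarrow> 'p) \<Rightarrow> 'p \<Rightarrow> nat" where
  "block_dim b i = card {k. b k = i}"

definition block :: "('m::finite \<Rightarrow> 'p) \<Rightarrow> 'p \<Rightarrow> real ^ 'm \<Rightarrow> real ^ 'm" where
  "block b i x = (\<chi> k. if b k = i then x $ k else 0)"

definition block_update :: "('m::finite \<Rightarrow> 'p) \<Rightarrow> 'p \<Rightarrow> real ^ 'm \<Rightarrow> real ^ 'm \<Rightarrow> real ^ 'm" where
  "block_update b i x z = (\<chi> k. if b k = i then z $ k else x $ k)"

text \<open>
  The column block \<open>A_i\<close> of \<open>A = [A_1, ..., A_p]\<close>, padded with zero columns outside
  block \<open>i\<close>.  Hence \<open>A x = A_1 x_1 + ... + A_p x_p\<close>, and \<open>A_i\<^sup>T A_l\<close> is the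
  \<open>(i,l)\<close> block sitting at its place in a matrix that is zero elsewhere.
\<close>

definition col_block :: "('m::finite \<Rightarrow> 'p) \<Rightarrow> 'p \<Rightarrow> real ^ 'm ^ 'n \<Rightarrow> real ^ 'm ^ 'n" where
  "col_block b i A = (\<chi> r k. if b k = i then A $ r $ k else 0)"

text \<open>Convex analysis relative to a linear subspace \<open>V\<close> (used with \<open>V = R^{m_i}\<close>).
  A real-valued function on \<open>V\<close> is automatically proper, \<open>V\<close> being nonempty.\<close>

definition closed_proper_convex_on :: "'a::euclidean_space set \<Rightarrow> ('a \<Rightarrow> real) \<Rightarrow> bool" where
  "closed_proper_convex_on V f \<longleftrightarrow> V \<noteq> {} \<and> convex_on V f \<and> closed (epigraph V f)"

definition subdiff_on :: "'a::euclidean_space set \<Rightarrow> ('a \<Rightarrow> real) \<Rightarrow> 'a \<Rightarrow> 'a set" where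
  "subdiff_on V f x = {v. x \<in> V \<and> v \<in> V \<and> (\<forall>z\<in>V. f z \<ge> f x + v \<bullet> (z - x))}"

definition piecewise_linear_mf ::
    "('a::euclidean_space \<Rightarrow> 'b::euclidean_space set) \<Rightarrow> bool" where
  "piecewise_linear_mf \<phi> \<longleftrightarrow>
     (\<exists>F. finite F \<and> (\<forall>P\<in>F. polyhedron P) \<and> {(x, y). y \<in> \<phi> x} = \<Union>F)"

text \<open>
  For \<open>V = block_space b i\<close> and \<open>S = A_i\<^sup>T A_i\<close> these are the eigenvalues of the
  \<open>m_i \<times> m_i\<close> matrix; the zero eigenvalues caused only by the padding are excluded.
\<close>

definition eigenvalues_on :: "(real ^ 'k::finite) set \<Rightarrow> real ^ 'k ^ 'k \<Rightarrow> real set" where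
  "eigenvalues_on V S = {e. \<exists>v\<in>V. v \<noteq> 0 \<and> S *v v = e *s v}"

definition lambda_max_on :: "(real ^ 'k::finite) set \<Rightarrow> real ^ 'k ^ 'k \<Rightarrow> real" where
  "lambda_max_on V S = Max (eigenvalues_on V S)"

definition lambda_max :: "real ^ 'k ^ 'k::finite \<Rightarrow> real" where
  "lambda_max S = Max (eigenvalues_on UNIV S)"

definition lambda_min :: "real ^ 'k ^ 'k::finite \<Rightarrow> real" where
  "lambda_min S = Min (eigenvalues_on UNIV S)"

definition sq_norm :: "real ^ 'k ^ 'k::finite \<Rightarrow> real ^ 'k \<Rightarrow> real" where
  "sq_norm G x = x \<bullet> (G *v x)"

text \<open>The minimum over \<open>S\<close> is rendered as an infimum; both agree whenever the minimum exists.\<close>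

definition dist_sq :: "real ^ 'k ^ 'k::finite \<Rightarrow> real ^ 'k \<Rightarrow> (real ^ 'k) set \<Rightarrow> real" where
  "dist_sq H w S = (INF w'\<in>S. sq_norm H (w - w'))"

text \<open>Triples \<open>w = (x, y, \<lambda>)\<close> as vectors, and matrices in the corresponding \<open>3 \<times> 3\<close>
  block form.\<close>

definition stack ::
    "real ^ 'm::finite \<Rightarrow> real ^ 'd::finite \<Rightarrow> real ^ 'n::finite \<Rightarrow> real ^ ('m + 'd + 'n)" where
  "stack x y l = (\<chi> k. case k of Inl a \<Rightarrow> x $ a | Inr (Inl b) \<Rightarrow> y $ b | Inr (Inr r) \<Rightarrow> l $ r)"

definition x_part :: "real ^ ('m::finite + 'd::finite + 'n::finite) \<Rightarrow> real ^ 'm" where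
  "x_part w = (\<chi> a. w $ Inl a)"

definition y_part :: "real ^ ('m::finite + 'd::finite + 'n::finite) \<Rightarrow> real ^ 'd" where
  "y_part w = (\<chi> b. w $ Inr (Inl b))"

definition l_part :: "real ^ ('m::finite + 'd::finite + 'n::finite) \<Rightarrow> real ^ 'n" where
  "l_part w = (\<chi> r. w $ Inr (Inr r))"

definition block_matrix3 ::
    "real ^ 'm ^ 'm::finite \<Rightarrow> real ^ 'd ^ 'm \<Rightarrow> real ^ 'n ^ 'm \<Rightarrow>
     real ^ 'm ^ 'd \<Rightarrow> real ^ 'd ^ 'd::finite \<Rightarrow> real ^ 'n ^ 'd \<Rightarrow>
     real ^ 'm ^ 'n \<Rightarrow> real ^ 'd ^ 'n \<Rightarrow> real ^ 'n ^ 'n::finite \<Rightarrow>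
     real ^ ('m + 'd + 'n) ^ ('m + 'd + 'n)" where
  "block_matrix3 xx xy xl yx yy yl lx ly ll = (\<chi> k. case k of
       Inl a \<Rightarrow> stack (xx $ a) (xy $ a) (xl $ a)
     | Inr (Inl b) \<Rightarrow> stack (yx $ b) (yy $ b) (yl $ b)
     | Inr (Inr r) \<Rightarrow> stack (lx $ r) (ly $ r) (ll $ r))"

definition objective ::
    "('m::finite \<Rightarrow> 'p::finite) \<Rightarrow> ('d::finite \<Rightarrow> 'q::finite) \<Rightarrow>
     ('p \<Rightarrow> real ^ 'm \<Rightarrow> real) \<Rightarrow> ('q \<Rightarrow> real ^ 'd \<Rightarrow> real) \<Rightarrow> real ^ 'm \<Rightarrow> real ^ 'd \<Rightarrow> real" where
  "objective bx bd f g x y = (\<Sum>i\<in>UNIV. f i (block bx i x)) + (\<Sum>j\<in>UNIV. g j (block bd j y))"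

definition block_product :: "('m::finite \<Rightarrow> 'p) \<Rightarrow> ('p \<Rightarrow> (real ^ 'm) set) \<Rightarrow> (real ^ 'm) set" where
  "block_product b X = {x. \<forall>i. block b i x \<in> X i}"

definition is_solution where
  "is_solution bx bd f g A B c X Y x y \<longleftrightarrow>
     is_arg_min (\<lambda>(x, y). objective bx bd f g x y)
       (\<lambda>(x, y). A *v x + B *v y = c \<and> x \<in> block_product bx X \<and> y \<in> block_product bd Y) (x, y)"

definition aug_lagrangian where
  "aug_lagrangian bx bd f g A B c \<beta> x y l =
     objective bx bd f g x y - l \<bullet> (A *v x + B *v y - c)
       + \<beta> / 2 * (norm (A *v x + B *v y - c))\<^sup>2"

text \<open>\<open>w\<close> is a sequence generated by GS-ADMM from the arbitrary initial point \<open>w 0\<close>.\<close>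

definition lambda_half where
  "lambda_half A B c \<beta> \<tau> w k =
     l_part (w k) - (\<tau> * \<beta>) *\<^sub>R (A *v x_part (w (Suc k)) + B *v y_part (w k) - c)"

definition gs_admm ::
    "('m::finite \<Rightarrow> 'p::finite) \<Rightarrow> ('d::finite \<Rightarrow> 'q::finite) \<Rightarrow>
     ('p \<Rightarrow> real ^ 'm \<Rightarrow> real) \<Rightarrow> ('q \<Rightarrow> real ^ 'd \<Rightarrow> real) \<Rightarrow>
     real ^ 'm ^ 'n::finite \<Rightarrow> real ^ 'd ^ 'n \<Rightarrow> real ^ 'n \<Rightarrow>
     ('p \<Rightarrow> (real ^ 'm) set) \<Rightarrow> ('q \<Rightarrow> (real ^ 'd) set) \<Rightarrow>
     real \<Rightarrow> real \<Rightarrow> real \<Rightarrow> real \<Rightarrow> real \<Rightarrow> (nat \<Rightarrow> real ^ ('m + 'd + 'n)) \<Rightarrow> bool" where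
  "gs_admm bx bd f g A B c X Y \<beta> \<sigma>1 \<sigma>2 \<tau> s w \<longleftrightarrow> (\<forall>k.
     (\<forall>i. is_arg_min
        (\<lambda>z. aug_lagrangian bx bd f g A B c \<beta>
               (block_update bx i (x_part (w k)) z) (y_part (w k)) (l_part (w k))
             + \<sigma>1 * \<beta> / 2 * (norm (col_block bx i A *v (z - block bx i (x_part (w k)))))\<^sup>2)
        (\<lambda>z. z \<in> X i) (block bx i (x_part (w (Suc k))))) \<and>
     (\<forall>j. is_arg_min
        (\<lambda>z. aug_lagrangian bx bd f g A B c \<beta>
               (x_part (w (Suc k))) (block_update bd j (y_part (w k)) z)
               (lambda_half A B c \<beta> \<tau> w k)
             + \<sigma>2 * \<beta> / 2 * (norm (col_block bd j B *v (z - block bd j (y_part (w k)))))\<^sup>2)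
        (\<lambda>z. z \<in> Y j) (block bd j (y_part (w (Suc k))))) \<and>
     l_part (w (Suc k)) = lambda_half A B c \<beta> \<tau> w k
        - (s * \<beta>) *\<^sub>R (A *v x_part (w (Suc k)) + B *v y_part (w (Suc k)) - c))"

definition Hx_mat :: "('m::finite \<Rightarrow> 'p::finite) \<Rightarrow> real ^ 'm ^ 'n \<Rightarrow> real \<Rightarrow> real \<Rightarrow> real ^ 'm ^ 'm" where
  "Hx_mat bx A \<beta> \<sigma>1 = (\<Sum>i\<in>UNIV. \<Sum>l\<in>UNIV.
     (if i = l then \<sigma>1 * \<beta> else - \<beta>) *\<^sub>R (transpose (col_block bx i A) ** col_block bx l A))"

definition DB_mat :: "('d::finite \<Rightarrow> 'q::finite) \<Rightarrow> real ^ 'd ^ 'n \<Rightarrow> real ^ 'd ^ 'd" where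
  "DB_mat bd B = (\<Sum>j\<in>UNIV. transpose (col_block bd j B) ** col_block bd j B)"

definition Q_mat ::
    "('m::finite \<Rightarrow> 'p::finite) \<Rightarrow> ('d::finite \<Rightarrow> 'q::finite) \<Rightarrow>
     real ^ 'm ^ 'n::finite \<Rightarrow> real ^ 'd ^ 'n \<Rightarrow> real \<Rightarrow> real \<Rightarrow> real \<Rightarrow> real \<Rightarrow>
     real ^ ('m + 'd + 'n) ^ ('m + 'd + 'n)" where
  "Q_mat bx bd A B \<beta> \<sigma>1 \<sigma>2 \<tau> = block_matrix3
     (Hx_mat bx A \<beta> \<sigma>1) 0                                0
     0                   (((\<sigma>2 + 1) * \<beta>) *\<^sub>R DB_mat bd B) (- \<tau> *\<^sub>R transpose B)
     0                   (- B)                            ((1 / \<beta>) *\<^sub>R mat 1)"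

definition M_mat ::
    "real ^ 'd ^ 'n \<Rightarrow> real \<Rightarrow> real \<Rightarrow> real \<Rightarrow>
     real ^ ('m::finite + 'd::finite + 'n::finite) ^ ('m + 'd + 'n)" where
  "M_mat B \<beta> \<tau> s = block_matrix3
     (mat 1) 0                   0
     0       (mat 1)             0
     0       (- (s * \<beta>) *\<^sub>R B)   ((\<tau> + s) *\<^sub>R mat 1)"

definition H_mat ::
    "('m::finite \<Rightarrow> 'p::finite) \<Rightarrow> ('d::finite \<Rightarrow> 'q::finite) \<Rightarrow>
     real ^ 'm ^ 'n::finite \<Rightarrow> real ^ 'd ^ 'n \<Rightarrow> real \<Rightarrow> real \<Rightarrow> real \<Rightarrow> real \<Rightarrow> real \<Rightarrow>
     real ^ ('m + 'd + 'n) ^ ('m + 'd + 'n)" where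
  "H_mat bx bd A B \<beta> \<sigma>1 \<sigma>2 \<tau> s =
     Q_mat bx bd A B \<beta> \<sigma>1 \<sigma>2 \<tau> ** matrix_inv (M_mat B \<beta> \<tau> s)"

definition G_mat ::
    "('m::finite \<Rightarrow> 'p::finite) \<Rightarrow> ('d::finite \<Rightarrow> 'q::finite) \<Rightarrow>
     real ^ 'm ^ 'n::finite \<Rightarrow> real ^ 'd ^ 'n \<Rightarrow> real \<Rightarrow> real \<Rightarrow> real \<Rightarrow> real \<Rightarrow> real \<Rightarrow>
     real ^ ('m + 'd + 'n) ^ ('m + 'd + 'n)" where
  "G_mat bx bd A B \<beta> \<sigma>1 \<sigma>2 \<tau> s =
     Q_mat bx bd A B \<beta> \<sigma>1 \<sigma>2 \<tau> + transpose (Q_mat bx bd A B \<beta> \<sigma>1 \<sigma>2 \<tau>)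
       - transpose (M_mat B \<beta> \<tau> s) ** Q_mat bx bd A B \<beta> \<sigma>1 \<sigma>2 \<tau>"

definition J_map ::
    "real ^ 'm ^ 'n \<Rightarrow> real ^ 'd ^ 'n \<Rightarrow> real ^ 'n \<Rightarrow>
     real ^ ('m::finite + 'd::finite + 'n::finite) \<Rightarrow> real ^ ('m + 'd + 'n)" where
  "J_map A B c w = stack (- (transpose A *v l_part w)) (- (transpose B *v l_part w))
                         (A *v x_part w + B *v y_part w - c)"

definition M_set ::
    "('m::finite \<Rightarrow> 'p) \<Rightarrow> ('d::finite \<Rightarrow> 'q) \<Rightarrow> ('p \<Rightarrow> (real ^ 'm) set) \<Rightarrow> ('q \<Rightarrow> (real ^ 'd) set) \<Rightarrow>
     (real ^ ('m + 'd + 'n::finite)) set" where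
  "M_set bx bd X Y = {w. x_part w \<in> block_product bx X \<and> y_part w \<in> block_product bd Y}"

definition M_star ::
    "('m::finite \<Rightarrow> 'p::finite) \<Rightarrow> ('d::finite \<Rightarrow> 'q::finite) \<Rightarrow>
     ('p \<Rightarrow> real ^ 'm \<Rightarrow> real) \<Rightarrow> ('q \<Rightarrow> real ^ 'd \<Rightarrow> real) \<Rightarrow>
     real ^ 'm ^ 'n \<Rightarrow> real ^ 'd ^ 'n \<Rightarrow> real ^ 'n \<Rightarrow>
     ('p \<Rightarrow> (real ^ 'm) set) \<Rightarrow> ('q \<Rightarrow> (real ^ 'd) set) \<Rightarrow>
     (real ^ ('m + 'd + 'n::finite)) set" where
  "M_star bx bd f g A B c X Y = (\<Inter>w\<in>M_set bx bd X Y.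
     {w' \<in> M_set bx bd X Y.
        objective bx bd f g (x_part w) (y_part w) - objective bx bd f g (x_part w') (y_part w')
        + (w - w') \<bullet> J_map A B c w \<ge> 0})"

text \<open>\<open>gram_max b i A\<close> is \<open>\<lambda>\<^sub>m\<^sub>a\<^sub>x (A_i\<^sup>T A_i)\<close>.\<close>

definition gram_max :: "('m::finite \<Rightarrow> 'p) \<Rightarrow> 'p \<Rightarrow> real ^ 'm ^ 'n \<Rightarrow> real" where
  "gram_max b i A =
     lambda_max_on (block_space b i) (transpose (col_block b i A) ** col_block b i A)"

definition theta_bar ::
    "('m::finite \<Rightarrow> 'p::finite) \<Rightarrow> real ^ 'm ^ 'n \<Rightarrow> real \<Rightarrow> real \<Rightarrow> 'p \<Rightarrow> real" where
  "theta_bar bx A \<beta> \<sigma>1 i =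
     4 * real CARD('p) * (1 - \<sigma>1)\<^sup>2 * \<beta>\<^sup>2 * (\<Sum>l\<in>UNIV. gram_max bx l A)
       + 4 * \<beta>\<^sup>2 * gram_max bx i A"

definition vartheta_bar ::
    "('m::finite \<Rightarrow> 'p::finite) \<Rightarrow> ('d::finite \<Rightarrow> 'q::finite) \<Rightarrow>
     real ^ 'm ^ 'n \<Rightarrow> real ^ 'd ^ 'n \<Rightarrow> real \<Rightarrow> real \<Rightarrow> real \<Rightarrow> 'q \<Rightarrow> real" where
  "vartheta_bar bx bd A B \<beta> \<sigma>2 s j =
     4 * real CARD('q) * (s * \<beta>)\<^sup>2 * (\<Sum>l\<in>UNIV. gram_max bx l A)
       + 3 * real CARD('q) * (s * \<beta>)\<^sup>2 * (\<Sum>l\<in>UNIV. gram_max bd l B)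
       + 3 * (\<sigma>2 + 1)\<^sup>2 * \<beta>\<^sup>2 * gram_max bd j B + 2 * real CARD('q)"

definition eta_bar ::
    "('m::finite \<Rightarrow> 'p::finite) \<Rightarrow> ('d::finite \<Rightarrow> 'q::finite) \<Rightarrow>
     real ^ 'm ^ 'n \<Rightarrow> real ^ 'd ^ 'n \<Rightarrow> real \<Rightarrow> real \<Rightarrow> real \<Rightarrow> real" where
  "eta_bar bx bd A B \<beta> \<tau> s =
     4 * (\<tau> + s - 1)\<^sup>2 * (\<Sum>l\<in>UNIV. gram_max bx l A)
       + 3 * (s - 1)\<^sup>2 * (\<Sum>l\<in>UNIV. gram_max bd l B) + 2 / \<beta>\<^sup>2"

definition delta_const ::
    "('m::finite \<Rightarrow> 'p::finite) \<Rightarrow> ('d::finite \<Rightarrow> 'q::finite) \<Rightarrow>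
     real ^ 'm ^ 'n \<Rightarrow> real ^ 'd ^ 'n \<Rightarrow> real \<Rightarrow> real \<Rightarrow> real \<Rightarrow> real \<Rightarrow> real \<Rightarrow> real" where
  "delta_const bx bd A B \<beta> \<sigma>1 \<sigma>2 \<tau> s =
     Max (range (theta_bar bx A \<beta> \<sigma>1) \<union> range (vartheta_bar bx bd A B \<beta> \<sigma>2 s)
          \<union> {eta_bar bx bd A B \<beta> \<tau> s})"

end

theory Submission
  imports Defs
begin

text \<open>
  In the variables \<open>w\<close>, one sweep of the algorithm is a prediction \<open>w'\<close> followed by the
  correction \<open>w\<^sub>+ = w + M (w' - w)\<close>, and \<open>w'\<close> satisfies the optimality conditions up to the
  residual \<open>Q (w' - w)\<close>.  Since \<open>H M = Q\<close>, monotonicity of the conditions gives the Fejer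
  inequality \<open>|w\<^sub>+ - w\<^sup>*|\<^sub>H\<^sup>2 \<le> |w - w\<^sup>*|\<^sub>H\<^sup>2 - |w' - w|\<^sub>G\<^sup>2\<close> for every primal-dual solution \<open>w\<^sup>*\<close>.
  Piecewise linearity of the subdifferentials makes the graph of the optimality conditions a
  finite union of polyhedra, so a Hoffman-type argument bounds the distance from \<open>w'\<close> to the
  solutions by a multiple of the residual once the residual is small; large residuals are
  covered by the boundedness of the iterates.  Hence \<open>dist (w\<^sub>+)\<close> is at most a multiple of
  \<open>|w' - w|\<close>, which turns the Fejer inequality into a linear rate.  The constant \<open>\<zeta>\<close> enters only
  through \<open>\<epsilon>\<close> and is chosen to reproduce the rate obtained this way.
\<close>

subsection \<open>Eigenvalues of symmetric matrices\<close>

text \<open>Two features shape the argument. The functions are finite on the whole space and the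
  constraint sets are polyhedral, so subgradients and multipliers come from separation and Farkas
  without a constraint qualification; in particular primal solvability already makes the set of
  primal-dual solutions nonempty. And a Hoffman bound on a finite union of polyhedra is only local:
  a piece without exact solutions offers no nearby one and can merely be kept at a positive
  residual. Large residuals therefore need the bound on the iterates, through which the rate, and
  with it \<zeta>, may depend on the starting point. For the prescribed formula to be solvable for
  \<zeta>, its other factors must be positive; this is the purpose of the spectral facts
  below.\<close>

lemma nonneg_quadratic_imp_linear_term_zero:
  fixes a b :: real
  assumes "\<And>t. 0 \<le> 2 * t * a + t\<^sup>2 * b"
  shows "a = 0"
proof (rule ccontr)
  assume "a \<noteq> 0"
  \<comment> \<open>\<open>K\<close> is positive and exceeds \<open>b\<close>, so at t = - a / K the
    linear term outweighs the quadratic one.\<close>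
  define K where "K = \<bar>b\<bar> + 1"
  have K: "0 < K" "b < K" by (auto simp: K_def)
  have "0 \<le> 2 * (- a / K) * a + (- a / K)\<^sup>2 * b"
    by (rule assms)
  also have "\<dots> = a\<^sup>2 / K\<^sup>2 * (b - 2 * K)"
    using K(1) by (simp add: power2_eq_square field_simps)
  also have "\<dots> < 0"
    using K \<open>a \<noteq> 0\<close> by (intro mult_pos_neg divide_pos_pos) auto
  finally show False by simp
qed

text \<open>A maximiser v of the Rayleigh quotient on the unit sphere of \<open>V\<close> is an
  eigenvector: e I - S is positive semidefinite on \<open>V\<close> and vanishes at v, so v is
  orthogonal to \<open>V\<close> under this form. Invariance puts e v - S v into \<open>V\<close>,
  hence it is orthogonal to itself. The subspace is there for the padded block matrices.\<close>

lemma symmetric_eigenvalues_on_nonempty: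
  fixes S :: "real ^ 'k::finite ^ 'k"
  assumes sym: "\<And>x y. x \<bullet> (S *v y) = y \<bullet> (S *v x)"
    and V: "subspace V" and inv: "\<And>x. x \<in> V \<Longrightarrow> S *v x \<in> V"
    and v0: "v0 \<in> V" "v0 \<noteq> 0"
  shows "eigenvalues_on V S \<noteq> {}"
proof -
  let ?K = "sphere 0 1 \<inter> V"
  have "compact ?K"
    by (intro compact_Int_closed closed_subspace V) auto
  moreover have "(1 / norm v0) *\<^sub>R v0 \<in> ?K"
    using v0 V by (auto simp: subspace_scale)
  moreover have "continuous_on ?K (\<lambda>x. x \<bullet> (S *v x))"
    by (intro continuous_intros linear_continuous_on linear_conv_bounded_linear[THEN iffD1]) auto
  ultimately obtain v where v: "v \<in> ?K" and max: "\<And>y. y \<in> ?K \<Longrightarrow> y \<bullet> (S *v y) \<le> v \<bullet> (S *v v)"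
    using continuous_attains_sup[of ?K "\<lambda>x. x \<bullet> (S *v x)"] by blast
  define e where "e = v \<bullet> (S *v v)"
  define Bf where "Bf = (\<lambda>x y. e * (x \<bullet> y) - x \<bullet> (S *v y))"
  have Bf_nonneg: "Bf x x \<ge> 0" if "x \<in> V" for x
  proof (cases "x = 0")
    case False
    have "(1 / norm x) *\<^sub>R x \<in> ?K" using False that V by (auto simp: subspace_scale)
    from max[OF this] have "(x \<bullet> (S *v x)) / (norm x)\<^sup>2 \<le> e"
      by (simp add: e_def matrix_vector_mult_scaleR power2_eq_square)
    then show ?thesis
      using False by (simp add: Bf_def divide_le_eq dot_square_norm)
  qed (simp add: Bf_def)
  have "v \<in> V" "norm v = 1" using v by auto
  have Bv: "Bf v v = 0"
    using \<open>norm v = 1\<close> by (simp add: Bf_def e_def dot_square_norm)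
  have Bf0: "Bf y v = 0" if "y \<in> V" for y
  proof (rule nonneg_quadratic_imp_linear_term_zero)
    fix t :: real
    have "0 \<le> Bf (v + t *\<^sub>R y) (v + t *\<^sub>R y)"
      by (intro Bf_nonneg subspace_add subspace_scale V \<open>v \<in> V\<close> that)
    also have "\<dots> = Bf v v + 2 * t * Bf y v + t\<^sup>2 * Bf y y"
      using sym[of v y]
      by (simp add: Bf_def matrix_vector_right_distrib matrix_vector_mult_scaleR inner_add_left
          inner_add_right power2_eq_square algebra_simps inner_commute)
    finally show "0 \<le> 2 * t * Bf y v + t\<^sup>2 * Bf y y" using Bv by simp
  qed
  let ?d = "e *\<^sub>R v - S *v v"
  have "?d \<in> V" by (intro subspace_diff subspace_scale V inv \<open>v \<in> V\<close>)
  from Bf0[OF this] have "?d \<bullet> ?d = 0" by (simp add: Bf_def inner_diff_right)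
  then have "S *v v = e *s v" by (simp add: scalar_mult_eq_scaleR)
  then show ?thesis
    using \<open>v \<in> V\<close> \<open>norm v = 1\<close> unfolding eigenvalues_on_def by fastforce
qed

text \<open>Eigenvectors of distinct eigenvalues are orthogonal, hence independent, hence finitely
  many. With nonemptiness this makes \<open>Max\<close> and \<open>Min\<close> of the spectrum
  attained.\<close>

lemma finite_symmetric_eigenvalues_on:
  fixes S :: "real ^ 'k::finite ^ 'k"
  assumes sym: "\<And>x y. x \<bullet> (S *v y) = y \<bullet> (S *v x)"
  shows "finite (eigenvalues_on V S)"
proof -
  have "\<forall>e\<in>eigenvalues_on V S. \<exists>v. v \<noteq> 0 \<and> S *v v = e *s v"
    unfolding eigenvalues_on_def by blast
  then obtain v where v: "\<And>e. e \<in> eigenvalues_on V S \<Longrightarrow> v e \<noteq> 0 \<and> S *v v e = e *s v e"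
    by metis
  have orth: "v e \<bullet> v e' = 0"
    if "e \<in> eigenvalues_on V S" "e' \<in> eigenvalues_on V S" "e \<noteq> e'" for e e'
    using sym[of "v e" "v e'"] v[OF that(1)] v[OF that(2)] that(3)
    by (auto simp: scalar_mult_eq_scaleR inner_commute)
  have "inj_on v (eigenvalues_on V S)"
  proof (rule inj_onI, rule ccontr)
    fix e e' assume "e \<in> eigenvalues_on V S" "e' \<in> eigenvalues_on V S" "v e = v e'" "e \<noteq> e'"
    with orth[of e e'] v[of e] show False by simp
  qed
  moreover have "independent (v ` eigenvalues_on V S)"
  proof (rule pairwise_orthogonal_independent)
    show "pairwise orthogonal (v ` eigenvalues_on V S)"
      using orth by (auto simp: pairwise_def orthogonal_def)
    show "0 \<notin> v ` eigenvalues_on V S" using v by force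
  qed
  then have "finite (v ` eigenvalues_on V S)" by (rule independent_imp_finite)
  ultimately show ?thesis by (rule finite_imageD[rotated])
qed

lemma eigenvalue_nonneg:
  fixes S :: "real ^ 'k::finite ^ 'k"
  assumes "e \<in> eigenvalues_on V S" and "\<And>x. 0 \<le> x \<bullet> (S *v x)"
  shows "0 \<le> e"
proof -
  obtain v where "v \<noteq> 0" "S *v v = e *s v"
    using assms(1) unfolding eigenvalues_on_def by blast
  then show ?thesis
    using assms(2)[of v] inner_gt_zero_iff[of v] mult_neg_pos[of e "v \<bullet> v"]
    by (force simp only: scalar_mult_eq_scaleR inner_scaleR_right)
qed

lemma eigenvalue_pos:
  fixes S :: "real ^ 'k::finite ^ 'k"
  assumes "e \<in> eigenvalues_on V S" and "\<And>x. x \<noteq> 0 \<Longrightarrow> 0 < x \<bullet> (S *v x)"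
  shows "0 < e"
proof -
  obtain v where "v \<noteq> 0" "S *v v = e *s v"
    using assms(1) unfolding eigenvalues_on_def by blast
  then show ?thesis
    using assms(2)[of v] inner_gt_zero_iff[of v] zero_less_mult_pos2[of e "v \<bullet> v"]
    by (force simp only: scalar_mult_eq_scaleR inner_scaleR_right)
qed

lemma eigenvalues_on_UNIV_nonempty:
  fixes S :: "real ^ 'k::finite ^ 'k"
  assumes sym: "\<And>x y. x \<bullet> (S *v y) = y \<bullet> (S *v x)"
  shows "eigenvalues_on UNIV S \<noteq> {}"
proof (rule symmetric_eigenvalues_on_nonempty[OF sym])
  show "axis undefined 1 \<noteq> (0 :: real ^ 'k)" by (simp add: axis_eq_0_iff)
qed auto

lemma lambda_min_pos:
  fixes S :: "real ^ 'k::finite ^ 'k"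
  assumes sym: "\<And>x y. x \<bullet> (S *v y) = y \<bullet> (S *v x)" and pd: "\<And>x. x \<noteq> 0 \<Longrightarrow> 0 < x \<bullet> (S *v x)"
  shows "0 < lambda_min S"
  unfolding lambda_min_def
  using finite_symmetric_eigenvalues_on[OF sym] eigenvalues_on_UNIV_nonempty[OF sym]
    eigenvalue_pos[OF _ pd] by (metis Min_in)

lemma lambda_max_pos:
  fixes S :: "real ^ 'k::finite ^ 'k"
  assumes sym: "\<And>x y. x \<bullet> (S *v y) = y \<bullet> (S *v x)" and pd: "\<And>x. x \<noteq> 0 \<Longrightarrow> 0 < x \<bullet> (S *v x)"
  shows "0 < lambda_max S"
  unfolding lambda_max_def
  using finite_symmetric_eigenvalues_on[OF sym] eigenvalues_on_UNIV_nonempty[OF sym]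
    eigenvalue_pos[OF _ pd] by (metis Max_in)

text \<open>The constant is the minimum of the form on the compact unit sphere. The rate is built
  from such constants and is matched with the eigenvalues through \<zeta> at the very end.\<close>

lemma positive_definite_lower_bound:
  fixes S :: "real ^ 'k::finite ^ 'k"
  assumes pd: "\<And>x. x \<noteq> 0 \<Longrightarrow> 0 < x \<bullet> (S *v x)"
  obtains \<gamma> where "0 < \<gamma>" "\<And>x. \<gamma> * (norm x)\<^sup>2 \<le> x \<bullet> (S *v x)"
proof -
  have "continuous_on (sphere 0 1) (\<lambda>x. x \<bullet> (S *v x))"
    by (intro continuous_intros linear_continuous_on linear_conv_bounded_linear[THEN iffD1]) auto
  moreover have "axis undefined 1 \<in> sphere (0 :: real ^ 'k) 1" by simp
  ultimately obtain v where v: "norm v = 1"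
    and min: "\<And>y. norm y = 1 \<Longrightarrow> v \<bullet> (S *v v) \<le> y \<bullet> (S *v y)"
    using continuous_attains_inf[of "sphere 0 1" "\<lambda>x. x \<bullet> (S *v x)"] by fastforce
  have "(v \<bullet> (S *v v)) * (norm x)\<^sup>2 \<le> x \<bullet> (S *v x)" for x
  proof (cases "x = 0")
    case False
    from min[of "(1 / norm x) *\<^sub>R x"] False have "v \<bullet> (S *v v) \<le> (x \<bullet> (S *v x)) / (norm x)\<^sup>2"
      by (simp add: matrix_vector_mult_scaleR power2_eq_square)
    then show ?thesis using False by (simp add: le_divide_eq)
  qed simp
  moreover have "0 < v \<bullet> (S *v v)" using pd[of v] v by fastforce
  ultimately show ?thesis using that by blast
qed

lemma quadratic_form_upper_bound:
  fixes S :: "real ^ 'k::finite ^ 'k"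
  obtains \<Lambda> where "0 < \<Lambda>" "\<And>x. x \<bullet> (S *v x) \<le> \<Lambda> * (norm x)\<^sup>2"
proof -
  obtain K where K: "0 < K" "\<And>x. norm (S *v x) \<le> norm x * K"
    using bounded_linear.pos_bounded[OF matrix_vector_mul_bounded_linear[of S]] by blast
  have "x \<bullet> (S *v x) \<le> K * (norm x)\<^sup>2" for x
  proof -
    have "x \<bullet> (S *v x) \<le> norm x * norm (S *v x)" by (rule norm_cauchy_schwarz)
    also have "\<dots> \<le> norm x * (norm x * K)" by (intro mult_left_mono K) auto
    finally show ?thesis by (simp add: power2_eq_square mult_ac)
  qed
  with K(1) show ?thesis using that by blast
qed

subsection \<open>A Hoffman-type error bound for polyhedra\<close>

lemma polyhedron_halfspaces:
  fixes P :: "'a::euclidean_space set"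
  assumes "polyhedron P"
  obtains I :: "('a \<times> real) set"
  where "finite I" "P = {x. \<forall>(a, b)\<in>I. a \<bullet> x \<le> b}"
proof -
  obtain F where F: "finite F" "P = \<Inter>F" "\<forall>h\<in>F. \<exists>a b. a \<noteq> 0 \<and> h = {x. a \<bullet> x \<le> b}"
    using assms unfolding polyhedron_def by blast
  then obtain \<alpha> \<gamma> where h: "\<And>h. h \<in> F \<Longrightarrow> h = {x. \<alpha> h \<bullet> x \<le> \<gamma> h}" by metis
  have "P = {x. \<forall>(a, b)\<in>(\<lambda>h. (\<alpha> h, \<gamma> h)) ` F. a \<bullet> x \<le> b}"
    using h F(2) by auto
  then show ?thesis using that[of "(\<lambda>h. (\<alpha> h, \<gamma> h)) ` F"] F(1) by blast
qed

lemma polyhedron_halfspacesI: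
  fixes I :: "('a::euclidean_space \<times> real) set"
  assumes "finite I"
  shows "polyhedron {x. \<forall>(a, b)\<in>I. a \<bullet> x \<le> b}"
proof -
  have "{x. \<forall>(a, b)\<in>I. a \<bullet> x \<le> b} = \<Inter>((\<lambda>(a, b). {x. a \<bullet> x \<le> b}) ` I)" by auto
  also have "polyhedron \<dots>"
    using assms by (intro polyhedron_Inter) (auto simp: polyhedron_halfspace_le)
  finally show ?thesis .
qed

text \<open>Active constraints do not increase along d, inactive ones have slack that survives a
  short step, and finitely many constraints share a common step length. Thus the active normals
  alone describe the feasible directions of a polyhedron.\<close>

lemma feasible_direction_step:
  fixes z d :: "'a::euclidean_space"
  assumes "finite I" and "\<forall>(a, b)\<in>I. a \<bullet> z \<le> b"
    and "\<forall>(a, b)\<in>I. a \<bullet> z = b \<longrightarrow> a \<bullet> d \<le> 0"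
  shows "\<exists>t>0. \<forall>(a, b)\<in>I. a \<bullet> (z + t *\<^sub>R d) \<le> b"
proof -
  have "eventually (\<lambda>t. a \<bullet> (z + t *\<^sub>R d) \<le> b) (at_right 0)" if "(a, b) \<in> I" for a b
  proof (cases "a \<bullet> z = b")
    case True
    then have "a \<bullet> d \<le> 0" using assms(3) that by auto
    then show ?thesis using True
      by (auto simp: eventually_at_right_field inner_add_right mult_nonneg_nonpos intro!: exI[of _ 1])
  next
    case False
    then have "a \<bullet> z < b" using assms(2) that by force
    moreover have "((\<lambda>t. a \<bullet> (z + t *\<^sub>R d)) \<longlongrightarrow> a \<bullet> (z + 0 *\<^sub>R d)) (at_right 0)"
      by (intro tendsto_intros)
    ultimately have "eventually (\<lambda>t. a \<bullet> (z + t *\<^sub>R d) < b) (at_right 0)"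
      by (intro order_tendstoD(2)) auto
    then show ?thesis by eventually_elim simp
  qed
  then have "eventually (\<lambda>t. \<forall>ab\<in>I. case ab of (a, b) \<Rightarrow> a \<bullet> (z + t *\<^sub>R d) \<le> b) (at_right 0)"
    using assms(1) by (intro eventually_ball_finite) auto
  then have "eventually (\<lambda>t. 0 < t \<and> (\<forall>ab\<in>I. case ab of (a, b) \<Rightarrow> a \<bullet> (z + t *\<^sub>R d) \<le> b)) (at_right (0::real))"
    using eventually_at_right_less by (rule eventually_elim2) auto
  then obtain t where "0 < t \<and> (\<forall>ab\<in>I. case ab of (a, b) \<Rightarrow> a \<bullet> (z + t *\<^sub>R d) \<le> b)"
    using eventually_happens'[OF trivial_limit_at_right_real] by blast
  then show ?thesis by auto
qed

text \<open>
  If \<open>z\<close> is the projection of \<open>p \<in> P\<close> onto \<open>P \<inter> ker L\<close>, then \<open>p - z\<close> is a feasible direction at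
  \<open>z\<close> and is polar to the feasible directions in \<open>ker L\<close>, so \<open>L\<close> does not annihilate it.  Both
  cones depend only on the set of active constraints at \<open>z\<close>; compactness of their unit spheres
  and finiteness of the number of active sets give a uniform constant.
\<close>

lemma polyhedron_kernel_error_bound:
  fixes L :: "'a::euclidean_space \<Rightarrow> 'b::euclidean_space"
  assumes P: "polyhedron P" and L: "linear L" and ne: "P \<inter> {x. L x = 0} \<noteq> {}"
  obtains \<kappa> where "0 < \<kappa>"
    "\<And>p. p \<in> P \<Longrightarrow> \<exists>z\<in>P. L z = 0 \<and> norm (p - z) \<le> \<kappa> * norm (L p)"
proof -
  obtain I where I: "finite I" "P = {x. \<forall>(a, b)\<in>I. a \<bullet> x \<le> b}"
    using polyhedron_halfspaces[OF P] by blast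
  define Z where "Z = P \<inter> {x. L x = 0}"
  have "closed {x. L x = 0}"
    using L by (intro closed_subspace) (simp add: linear_subspace_kernel)
  then have Z: "closed Z" "convex Z" "Z \<noteq> {}"
    using ne unfolding Z_def
    by (auto intro: closed_Int convex_Int polyhedron_imp_closed[OF P] polyhedron_imp_convex[OF P]
        subspace_imp_convex[OF linear_subspace_kernel[OF L]])
  define T where "T = (\<lambda>J :: ('a \<times> real) set. {d :: 'a. \<forall>(a, b)\<in>J. a \<bullet> d \<le> 0})"
  define C where "C = (\<lambda>J. {d. norm d = 1 \<and> d \<in> T J \<and> (\<forall>e\<in>T J. L e = 0 \<longrightarrow> d \<bullet> e \<le> 0)})"
  have contL: "continuous_on X L" for X
    using L by (simp add: linear_continuous_on linear_conv_bounded_linear)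
  have "\<exists>\<kappa>>0. \<forall>d\<in>C J. \<kappa> \<le> norm (L d)" for J
  proof (cases "C J = {}")
    case False
    have "C J = sphere 0 1 \<inter> ((\<Inter>(a, b)\<in>J. {d. a \<bullet> d \<le> 0}) \<inter> (\<Inter>e\<in>{e\<in>T J. L e = 0}. {d. e \<bullet> d \<le> 0}))"
      unfolding C_def T_def by (auto simp: inner_commute)
    moreover have "compact \<dots>"
      by (intro compact_Int_closed compact_sphere closed_Int closed_INT)
        (auto simp: closed_halfspace_le)
    ultimately have "compact (C J)" by simp
    then obtain d0 where d0: "d0 \<in> C J" "\<And>d. d \<in> C J \<Longrightarrow> norm (L d0) \<le> norm (L d)"
      using continuous_attains_inf[of "C J" "\<lambda>d. norm (L d)"] False
        continuous_on_norm[OF contL] by blast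
    \<comment> \<open>A kernel vector in \<open>C J\<close> would be among the directions it is
      polar to, hence polar to itself.\<close>
    have "L d0 \<noteq> 0"
    proof
      assume "L d0 = 0"
      with d0(1) have "d0 \<bullet> d0 \<le> 0" "norm d0 = 1" unfolding C_def by blast+
      then show False by (simp add: dot_square_norm)
    qed
    then show ?thesis using d0(2) by (intro exI[of _ "norm (L d0)"]) auto
  qed (auto intro: exI[of _ 1])
  then obtain \<kappa> where \<kappa>: "\<And>J. 0 < \<kappa> J" "\<And>J d. d \<in> C J \<Longrightarrow> \<kappa> J \<le> norm (L d)" by metis
  \<comment> \<open>The minimum runs over all subsets of \<open>I\<close>, whether or not they occur
    as active sets; where \<open>C J\<close> is empty any positive constant is admissible.\<close>
  define m where "m = Min (\<kappa> ` Pow I)"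
  have m: "0 < m"
    using I(1) \<kappa>(1) unfolding m_def by (subst Min_gr_iff) auto
  have m_le: "m \<le> \<kappa> J" if "J \<subseteq> I" for J
    using I(1) that by (simp add: m_def)
  have "\<exists>z\<in>P. L z = 0 \<and> norm (p - z) \<le> 1 / m * norm (L p)" if "p \<in> P" for p
  proof -
    define z where "z = closest_point Z p"
    have z: "z \<in> Z" using Z by (simp add: z_def closest_point_in_set)
    then have Lz: "L z = 0" and zP: "z \<in> P" and zI: "\<forall>(a, b)\<in>I. a \<bullet> z \<le> b"
      using I(2) by (auto simp: Z_def)
    have "norm (p - z) \<le> 1 / m * norm (L p)"
    proof (cases "p = z")
      case True
      then show ?thesis using m by simp
    next
      case False
      define J where "J = {(a, b) \<in> I. a \<bullet> z = b}"
      define d where "d = (1 / norm (p - z)) *\<^sub>R (p - z)"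
      have T: "p - z \<in> T J"
        using that I(2) by (auto simp: T_def J_def inner_diff_right)
      have "(p - z) \<bullet> e \<le> 0" if e: "e \<in> T J" "L e = 0" for e
      proof -
        have "\<forall>(a, b)\<in>I. a \<bullet> z = b \<longrightarrow> a \<bullet> e \<le> 0"
          using e(1) by (auto simp: T_def J_def)
        then obtain t where t: "t > 0" "\<forall>(a, b)\<in>I. a \<bullet> (z + t *\<^sub>R e) \<le> b"
          using feasible_direction_step[OF I(1) zI] by blast
        have "z + t *\<^sub>R e \<in> Z"
          using t(2) e(2) Lz I(2) by (simp add: Z_def linear_add[OF L] linear_scale[OF L])
        from closest_point_dot[OF Z(2,1) this, of p] t(1)
        show ?thesis by (simp add: z_def mult_le_0_iff)
      qed
      with T False have "d \<in> C J"
        by (auto simp: C_def d_def T_def mult_le_0_iff divide_le_0_iff split_beta)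
      with \<kappa>(2) m_le[of J] have "m \<le> norm (L d)"
        by (fastforce simp: J_def)
      also have "norm (L d) = norm (L p) / norm (p - z)"
        using Lz by (simp add: d_def linear_scale[OF L] linear_diff[OF L])
      finally show ?thesis using False m by (simp add: field_simps)
    qed
    with Lz zP show ?thesis by blast
  qed
  with m show ?thesis using that[of "1 / m"] by simp
qed

text \<open>
  If \<open>P\<close> misses the kernel of \<open>L\<close>, the bound for the cone \<open>{(x, t). a \<bullet> x \<le> t b, 0 \<le> t}\<close> keeps \<open>L\<close> away
  from zero on \<open>P\<close>: a nearby kernel element \<open>(x, t)\<close> with \<open>t > 0\<close> would give \<open>x / t \<in> P\<close>.
\<close>

lemma polyhedron_local_error_bound:
  fixes L :: "'a::euclidean_space \<Rightarrow> 'b::euclidean_space"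
  assumes P: "polyhedron P" and L: "linear L"
  obtains \<kappa> where "0 < \<kappa>"
    "\<And>p. p \<in> P \<Longrightarrow> norm (L p) < 1 / \<kappa> \<Longrightarrow> \<exists>z\<in>P. L z = 0 \<and> norm (p - z) \<le> \<kappa> * norm (L p)"
proof (cases "P \<inter> {x. L x = 0} = {}")
  case False
  obtain \<kappa> where "0 < \<kappa>"
    "\<And>p. p \<in> P \<Longrightarrow> \<exists>z\<in>P. L z = 0 \<and> norm (p - z) \<le> \<kappa> * norm (L p)"
    by (rule polyhedron_kernel_error_bound[OF P L False]) blast
  then show ?thesis by (intro that) blast+
next
  case True
  obtain I where I: "finite I" "P = {x. \<forall>(a, b)\<in>I. a \<bullet> x \<le> b}"
    using polyhedron_halfspaces[OF P] by blast
  \<comment> \<open>The inserted pair \<open>((0, - 1), 0)\<close> encodes 0 \<le> t. Being a cone,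
    \<open>Q\<close> contains the origin, so it meets the kernel and the global bound applies to
    it.\<close>
  define Q :: "('a \<times> real) set" where
    "Q = {p. \<forall>(a, b)\<in>insert ((0, - 1), 0) ((\<lambda>(a, b). ((a, - b), 0)) ` I). a \<bullet> p \<le> b}"
  have Q: "(x, t) \<in> Q \<longleftrightarrow> 0 \<le> t \<and> (\<forall>(a, b)\<in>I. a \<bullet> x \<le> t * b)" for x t
    by (simp add: Q_def split_beta algebra_simps)
  have "polyhedron Q"
    unfolding Q_def using I(1) by (intro polyhedron_halfspacesI) auto
  moreover have "linear (\<lambda>p :: 'a \<times> real. L (fst p))"
    using linear_compose[OF linear_fst L] by (simp add: o_def)
  moreover have "(0, 0) \<in> Q \<inter> {p. L (fst p) = 0}"
    using linear_0[OF L] by (auto simp: Q)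
  then have "Q \<inter> {p. L (fst p) = 0} \<noteq> {}" by blast
  ultimately obtain \<kappa> where \<kappa>: "0 < \<kappa>"
    "\<And>p. p \<in> Q \<Longrightarrow> \<exists>z\<in>Q. L (fst z) = 0 \<and> norm (p - z) \<le> \<kappa> * norm (L (fst p))"
    by (rule polyhedron_kernel_error_bound) blast
  have "1 / \<kappa> \<le> norm (L p)" if p: "p \<in> P" for p
  proof (rule ccontr)
    assume less: "\<not> 1 / \<kappa> \<le> norm (L p)"
    have "(p, 1) \<in> Q" using p I(2) by (auto simp: Q)
    from \<kappa>(2)[OF this] obtain x t where xt: "(x, t) \<in> Q" "L x = 0"
      "norm ((p, 1) - (x, t)) \<le> \<kappa> * norm (L p)" by auto
    \<comment> \<open>The threshold 1 / \<kappa> is tuned so that the kernel element stays at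
      distance less than 1 from (p, 1); its height t then cannot drop to 0.\<close>
    have "\<bar>1 - t\<bar> \<le> norm ((p, 1) - (x, t))"
      using norm_snd_le[of "1 - t" "p - x"] by simp
    also have "\<dots> < 1"
      using xt(3) less \<kappa>(1) by (simp add: not_le less_divide_eq mult.commute)
    finally have "t > 0" by simp
    have "(1 / t) *\<^sub>R x \<in> P"
      unfolding I(2)
    proof safe
      fix a b assume "(a, b) \<in> I"
      then have "a \<bullet> x \<le> t * b" using xt(1) by (auto simp: Q)
      then show "a \<bullet> ((1 / t) *\<^sub>R x) \<le> b"
        using \<open>t > 0\<close> by (simp add: divide_le_eq mult.commute)
    qed
    moreover have "L ((1 / t) *\<^sub>R x) = 0" using xt(2) by (simp add: linear_scale[OF L])
    ultimately show False using True by blast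
  qed
  then have "\<not> norm (L p) < 1 / \<kappa>" if "p \<in> P" for p
    using that by (simp add: not_less)
  then show ?thesis using \<kappa>(1) by (intro that[of \<kappa>]) blast+
qed

subsection \<open>Finite unions of polyhedra\<close>

text \<open>The condition of \<open>piecewise_linear_mf\<close>, detached from graphs: for sets it
  is stable under finite intersections and linear preimages, which is how the graph of the
  optimality conditions is assembled.\<close>

definition polyhedral_union :: "'a::euclidean_space set \<Rightarrow> bool" where
  "polyhedral_union S \<longleftrightarrow> (\<exists>F. finite F \<and> (\<forall>P\<in>F. polyhedron P) \<and> S = \<Union>F)"

lemma polyhedron_imp_polyhedral_union: "polyhedron S \<Longrightarrow> polyhedral_union S"
  unfolding polyhedral_union_def by (intro exI[of _ "{S}"]) auto

lemma polyhedral_union_UN: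
  assumes "finite I" "\<And>i. i \<in> I \<Longrightarrow> polyhedron (S i)"
  shows "polyhedral_union (\<Union>i\<in>I. S i)"
  unfolding polyhedral_union_def using assms by (intro exI[of _ "S ` I"]) auto

lemma polyhedral_union_Int:
  assumes "polyhedral_union S" "polyhedral_union T"
  shows "polyhedral_union (S \<inter> T)"
proof -
  obtain F G where FG: "finite F" "\<forall>P\<in>F. polyhedron P" "S = \<Union>F"
    "finite G" "\<forall>P\<in>G. polyhedron P" "T = \<Union>G"
    using assms unfolding polyhedral_union_def by blast
  have "S \<inter> T = (\<Union>(P, P')\<in>F \<times> G. P \<inter> P')" using FG by auto
  also have "polyhedral_union \<dots>" using FG by (intro polyhedral_union_UN) auto
  finally show ?thesis .
qed

lemma polyhedral_union_INT:
  assumes "finite I" "\<And>i. i \<in> I \<Longrightarrow> polyhedral_union (S i)"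
  shows "polyhedral_union (\<Inter>i\<in>I. S i)"
  using assms
proof (induction I rule: finite_induct)
  case empty
  then show ?case by (simp add: polyhedron_imp_polyhedral_union)
next
  case (insert i I)
  then show ?case by (simp add: polyhedral_union_Int)
qed

lemma polyhedron_linear_vimage:
  fixes L :: "'a::euclidean_space \<Rightarrow> 'b::euclidean_space"
  assumes "polyhedron P" and L: "linear L"
  shows "polyhedron (L -` P)"
proof -
  obtain I where I: "finite I" "P = {x. \<forall>(a, b)\<in>I. a \<bullet> x \<le> b}"
    using polyhedron_halfspaces[OF assms(1)] by blast
  have "L -` P = {x. \<forall>(a, b)\<in>(\<lambda>(a, b). (adjoint L a, b)) ` I. a \<bullet> x \<le> b}"
    unfolding I(2) by (auto simp: adjoint_clauses(2)[OF L] split_beta)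
  also have "polyhedron \<dots>" using I(1) by (intro polyhedron_halfspacesI) auto
  finally show ?thesis .
qed

lemma polyhedral_union_linear_vimage:
  fixes L :: "'a::euclidean_space \<Rightarrow> 'b::euclidean_space"
  assumes "polyhedral_union S" and L: "linear L"
  shows "polyhedral_union (L -` S)"
proof -
  obtain F where F: "finite F" "\<forall>P\<in>F. polyhedron P" "S = \<Union>F"
    using assms unfolding polyhedral_union_def by blast
  have "L -` S = (\<Union>P\<in>F. L -` P)" using F by auto
  also have "polyhedral_union \<dots>"
    using F L by (intro polyhedral_union_UN) (auto intro: polyhedron_linear_vimage)
  finally show ?thesis .
qed

lemma polyhedral_union_local_error_bound:
  fixes L :: "'a::euclidean_space \<Rightarrow> 'b::euclidean_space"
  assumes "polyhedral_union S" and L: "linear L"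
  obtains \<kappa> where "0 < \<kappa>"
    "\<And>p. p \<in> S \<Longrightarrow> norm (L p) < 1 / \<kappa> \<Longrightarrow> \<exists>z\<in>S. L z = 0 \<and> norm (p - z) \<le> \<kappa> * norm (L p)"
proof -
  obtain F where F: "finite F" "\<forall>P\<in>F. polyhedron P" "S = \<Union>F"
    using assms unfolding polyhedral_union_def by blast
  have "\<forall>P\<in>F. \<exists>\<kappa>>0. \<forall>p\<in>P. norm (L p) < 1 / \<kappa> \<longrightarrow>
      (\<exists>z\<in>P. L z = 0 \<and> norm (p - z) \<le> \<kappa> * norm (L p))"
  proof
    fix P assume "P \<in> F"
    then have "polyhedron P" using F(2) by blast
    from polyhedron_local_error_bound[OF this L] show "\<exists>\<kappa>>0. \<forall>p\<in>P. norm (L p) < 1 / \<kappa> \<longrightarrow>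
      (\<exists>z\<in>P. L z = 0 \<and> norm (p - z) \<le> \<kappa> * norm (L p))" by metis
  qed
  then obtain \<kappa> where \<kappa>: "\<And>P. P \<in> F \<Longrightarrow> 0 < \<kappa> P"
    "\<And>P. P \<in> F \<Longrightarrow> \<forall>p\<in>P. norm (L p) < 1 / \<kappa> P \<longrightarrow>
      (\<exists>z\<in>P. L z = 0 \<and> norm (p - z) \<le> \<kappa> P * norm (L p))"
    by metis
  \<comment> \<open>Enlarging the constant weakens the bound and shrinks the threshold at once, so
    the maximum serves every piece; the 1 covers an empty \<open>F\<close>.\<close>
  define K where "K = Max (insert 1 (\<kappa> ` F))"
  have K: "0 < K" "\<And>P. P \<in> F \<Longrightarrow> \<kappa> P \<le> K"
    using F(1) by (auto simp: K_def Max_gr_iff)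
  show ?thesis
  proof (rule that[OF K(1)])
    fix p assume p: "p \<in> S" "norm (L p) < 1 / K"
    then obtain P where P: "P \<in> F" "p \<in> P" using F(3) by blast
    note p(2)
    also have "1 / K \<le> 1 / \<kappa> P"
      using K(2)[OF P(1)] \<kappa>(1)[OF P(1)] by (intro divide_left_mono) auto
    finally have "norm (L p) < 1 / \<kappa> P" .
    then obtain z where z: "z \<in> P" "L z = 0" "norm (p - z) \<le> \<kappa> P * norm (L p)"
      using \<kappa>(2)[OF P(1)] P(2) by blast
    note z(3)
    also have "\<kappa> P * norm (L p) \<le> K * norm (L p)"
      using K(2)[OF P(1)] by (intro mult_right_mono) auto
    finally show "\<exists>z\<in>S. L z = 0 \<and> norm (p - z) \<le> K * norm (L p)"
      using z(1,2) P(1) F(3) by blast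
  qed
qed

subsection \<open>Normal cones of polyhedra and multipliers\<close>

text \<open>Empty off \<open>C\<close>, so that membership in the graph also records feasibility of
  the base point.\<close>

definition normal_cone :: "'a::euclidean_space set \<Rightarrow> 'a \<Rightarrow> 'a set" where
  "normal_cone C x = {n. x \<in> C \<and> (\<forall>z\<in>C. n \<bullet> (z - x) \<le> 0)}"

text \<open>A finitely generated cone is closed, so a point outside it can be strictly separated
  from it. The cone property forces the separating functional to be nonnegative on the generators,
  and its negative then violates the polarity assumption.\<close>

lemma farkas:
  fixes S :: "'a::euclidean_space set"
  assumes "finite S" and pol: "\<And>d. (\<And>a. a \<in> S \<Longrightarrow> a \<bullet> d \<le> 0) \<Longrightarrow> n \<bullet> d \<le> 0"
  shows "n \<in> convex_cone hull S"
proof (rule ccontr)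
  assume "n \<notin> convex_cone hull S"
  then obtain a b where ab: "a \<bullet> n < b" "\<And>x. x \<in> convex_cone hull S \<Longrightarrow> b < a \<bullet> x"
    using separating_hyperplane_closed_point[of "convex_cone hull S" n]
      closed_convex_cone_hull[OF assms(1)] convex_convex_cone_hull by blast
  have "b < 0" using ab(2)[OF convex_cone_hull_contains_0] by simp
  have "0 \<le> a \<bullet> x" if "x \<in> S" for x
  proof (rule ccontr)
    assume "\<not> 0 \<le> a \<bullet> x"
    \<comment> \<open>The factor is positive, and it scales x to a point where the functional equals
      b, contradicting strict separation.\<close>
    then have "(b / (a \<bullet> x)) *\<^sub>R x \<in> convex_cone hull S"
      using that \<open>b < 0\<close> by (intro convex_cone_hull_mul hull_inc) (auto simp: divide_nonpos_neg)
    from ab(2)[OF this] \<open>\<not> 0 \<le> a \<bullet> x\<close> show False by simp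
  qed
  then have "n \<bullet> (- a) \<le> 0" by (intro pol) (simp add: inner_commute)
  then show False using ab(1) \<open>b < 0\<close> by (simp add: inner_commute)
qed

lemma convex_cone_hull_polar:
  assumes "n \<in> convex_cone hull S" and "\<And>a. a \<in> S \<Longrightarrow> a \<bullet> d \<le> 0"
  shows "n \<bullet> d \<le> 0"
proof -
  have "convex_cone hull S \<subseteq> {x. d \<bullet> x \<le> 0}"
    using assms(2) by (intro hull_minimal convex_cone_halfspace_le) (auto simp: inner_commute)
  then show ?thesis using assms(1) by (auto simp: inner_commute)
qed

text \<open>A normal vector is polar to all feasible directions, and these are exactly the
  directions polar to the active normals; Farkas does the rest.\<close>

lemma normal_cone_polyhedron:
  fixes I :: "('a::euclidean_space \<times> real) set"
  assumes I: "finite I" and x: "\<forall>(a, b)\<in>I. a \<bullet> x \<le> b"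
    and n: "n \<in> normal_cone {x. \<forall>(a, b)\<in>I. a \<bullet> x \<le> b} x"
  shows "n \<in> convex_cone hull (fst ` {(a, b) \<in> I. a \<bullet> x = b})"
proof (rule farkas)
  fix d assume "\<And>a. a \<in> fst ` {(a, b) \<in> I. a \<bullet> x = b} \<Longrightarrow> a \<bullet> d \<le> 0"
  then have "\<forall>(a, b)\<in>I. a \<bullet> x = b \<longrightarrow> a \<bullet> d \<le> 0" by (auto simp: image_iff)
  then obtain t where t: "t > 0" "\<forall>(a, b)\<in>I. a \<bullet> (x + t *\<^sub>R d) \<le> b"
    using feasible_direction_step[OF I x] by blast
  then have "n \<bullet> (x + t *\<^sub>R d - x) \<le> 0" using n unfolding normal_cone_def by blast
  then show "n \<bullet> d \<le> 0" using t(1) by (simp add: mult_le_0_iff)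
next
  show "finite (fst ` {(a, b) \<in> I. a \<bullet> x = b})"
    by (intro finite_imageI finite_subset[OF _ I]) blast
qed

text \<open>There is one piece per set J of constraints: the points of \<open>C\<close> where all of
  J is active, times the cone of the normals in J. Allowing further active constraints keeps the
  pieces closed, and is harmless because the cone of some active normals lies in the normal
  cone.\<close>

lemma polyhedral_union_normal_cone:
  fixes C :: "'a::euclidean_space set"
  assumes "polyhedron C"
  shows "polyhedral_union {(x, n). n \<in> normal_cone C x}"
proof -
  obtain I where I: "finite I" "C = {x. \<forall>(a, b)\<in>I. a \<bullet> x \<le> b}"
    using polyhedron_halfspaces[OF assms] by blast
  define piece where "piece = (\<lambda>J. fst -` (C \<inter> (\<Inter>(a, b)\<in>J. {x. a \<bullet> x = b}))
      \<inter> snd -` (convex_cone hull (fst ` J)))"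
  have "{(x, n). n \<in> normal_cone C x} = (\<Union>J\<in>Pow I. piece J)"
  proof (intro subset_antisym subsetI)
    fix p assume "p \<in> {(x, n). n \<in> normal_cone C x}"
    then obtain x n where p: "p = (x, n)" and n: "n \<in> normal_cone C x" by blast
    then have x: "x \<in> C" by (simp add: normal_cone_def)
    have "n \<in> convex_cone hull (fst ` {(a, b) \<in> I. a \<bullet> x = b})"
      using normal_cone_polyhedron[OF I(1)] n x unfolding I(2) by blast
    then have "p \<in> piece {(a, b) \<in> I. a \<bullet> x = b}"
      using x by (simp add: piece_def p split_beta)
    moreover have "{(a, b) \<in> I. a \<bullet> x = b} \<in> Pow I" by blast
    ultimately show "p \<in> (\<Union>J\<in>Pow I. piece J)" by (rule UN_I[rotated])
  next
    fix p assume "p \<in> (\<Union>J\<in>Pow I. piece J)"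
    then obtain x n J where p: "p = (x, n)" and J: "J \<subseteq> I" and "(x, n) \<in> piece J"
      by (metis UN_E PowD surj_pair)
    then have x: "x \<in> C" "\<And>a b. (a, b) \<in> J \<Longrightarrow> a \<bullet> x = b" and n: "n \<in> convex_cone hull (fst ` J)"
      by (auto simp: piece_def)
    have "n \<bullet> (z - x) \<le> 0" if "z \<in> C" for z
    proof (rule convex_cone_hull_polar[OF n])
      fix a assume "a \<in> fst ` J"
      then obtain b where ab: "(a, b) \<in> J" by auto
      then have "a \<bullet> z \<le> b" using J that I(2) by blast
      then show "a \<bullet> (z - x) \<le> 0" using x(2)[OF ab] by (simp add: inner_diff_right)
    qed
    then show "p \<in> {(x, n). n \<in> normal_cone C x}" using x(1) by (simp add: normal_cone_def p)
  qed
  also have "polyhedral_union \<dots>"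
  proof (rule polyhedral_union_UN)
    fix J assume "J \<in> Pow I"
    then have J: "finite J" using I(1) finite_subset by blast
    have "polyhedron (\<Inter>(a, b)\<in>J. {x. a \<bullet> x = b})"
      using J by (intro polyhedron_Inter) (auto simp: polyhedron_hyperplane)
    then have "polyhedron (C \<inter> (\<Inter>(a, b)\<in>J. {x. a \<bullet> x = b}))"
      by (rule polyhedron_Int[OF assms])
    moreover have "polyhedron (convex_cone hull (fst ` J))"
      using J by (intro polyhedron_convex_cone_hull finite_imageI)
    ultimately show "polyhedron (piece J)"
      unfolding piece_def
      using polyhedron_linear_vimage[OF _ linear_fst] polyhedron_linear_vimage[OF _ linear_snd]
      by (intro polyhedron_Int) blast+
  qed (use I(1) in auto)
  finally show ?thesis .
qed

text \<open>The vector n is normal at x to the slice of \<open>C\<close> on which \<open>E\<close>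
  is constant. For polyhedra this normal cone is the sum of the normal cone of \<open>C\<close> and
  the range of the adjoint, with no interior point required.\<close>

lemma multiplier_decomposition:
  fixes E :: "'a::euclidean_space \<Rightarrow> 'n::euclidean_space"
  assumes C: "polyhedron C" and E: "linear E" and x: "x \<in> C"
    and n: "\<And>z. z \<in> C \<Longrightarrow> E z = E x \<Longrightarrow> n \<bullet> (z - x) \<le> 0"
  obtains l where "n - adjoint E l \<in> normal_cone C x"
proof -
  obtain I where I: "finite I" "C = {x. \<forall>(a, b)\<in>I. a \<bullet> x \<le> b}"
    using polyhedron_halfspaces[OF C] by blast
  have xI: "\<forall>(a, b)\<in>I. a \<bullet> x \<le> b" using x I(2) by blast
  \<comment> \<open>Taking both signs of each basis vector expresses the equation E d = 0 by
    inequalities, as Farkas demands.\<close>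
  let ?S = "fst ` {(a, b) \<in> I. a \<bullet> x = b}" and ?R = "adjoint E ` (Basis \<union> uminus ` Basis)"
  have "n \<in> convex_cone hull (?S \<union> ?R)"
  proof (rule farkas)
    fix d assume d: "\<And>a. a \<in> ?S \<union> ?R \<Longrightarrow> a \<bullet> d \<le> 0"
    have "E d \<bullet> b = 0" if "b \<in> Basis" for b
    proof -
      have "adjoint E b \<in> ?R" "adjoint E (- b) \<in> ?R" using that by blast+
      then have "adjoint E b \<bullet> d \<le> 0" "adjoint E (- b) \<bullet> d \<le> 0" using d by blast+
      then show ?thesis by (simp add: adjoint_clauses(2)[OF E] inner_commute[of b])
    qed
    then have Ed: "E d = 0" using euclidean_all_zero_iff[of "E d"] by blast
    have "a \<bullet> d \<le> 0" if "(a, b) \<in> I" "a \<bullet> x = b" for a b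
    proof (rule d)
      have "(a, b) \<in> {(a, b) \<in> I. a \<bullet> x = b}" using that by blast
      then have "fst (a, b) \<in> ?S" by (rule imageI)
      then show "a \<in> ?S \<union> ?R" by simp
    qed
    then have "\<forall>(a, b)\<in>I. a \<bullet> x = b \<longrightarrow> a \<bullet> d \<le> 0" by blast
    then obtain t where t: "t > 0" "\<forall>(a, b)\<in>I. a \<bullet> (x + t *\<^sub>R d) \<le> b"
      using feasible_direction_step[OF I(1) xI] by blast
    have "n \<bullet> (x + t *\<^sub>R d - x) \<le> 0"
    proof (rule n)
      show "x + t *\<^sub>R d \<in> C" using t(2) by (simp only: I(2) mem_Collect_eq)
      show "E (x + t *\<^sub>R d) = E x" using Ed by (simp add: linear_add[OF E] linear_scale[OF E])
    qed
    then show "n \<bullet> d \<le> 0" using t(1) by (simp add: mult_le_0_iff)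
  next
    have "finite ?S" by (intro finite_imageI finite_subset[OF _ I(1)]) blast
    then show "finite (?S \<union> ?R)" by simp
  qed
  then have "n \<in> (\<Union>k\<in>convex_cone hull ?S. \<Union>r\<in>convex_cone hull ?R. {k + r})"
    by (simp only: convex_cone_hull_Un)
  then obtain k r where k: "k \<in> convex_cone hull ?S" and r: "r \<in> convex_cone hull ?R" and "n = k + r"
    by blast
  have "r \<in> range (adjoint E)"
    using r unfolding convex_cone_hull_linear_image[OF adjoint_linear[OF E]] by blast
  then obtain l where "r = adjoint E l" by blast
  moreover have "k \<in> normal_cone C x"
    unfolding normal_cone_def
  proof (intro CollectI conjI ballI)
    fix z assume z: "z \<in> C"
    show "k \<bullet> (z - x) \<le> 0"
    proof (rule convex_cone_hull_polar[OF k])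
      fix a assume "a \<in> ?S"
      then obtain b where ab: "(a, b) \<in> I" "a \<bullet> x = b" by auto
      then have "a \<bullet> z \<le> b" using z I(2) by blast
      then show "a \<bullet> (z - x) \<le> 0" using ab(2) by (simp add: inner_diff_right)
    qed
  qed (rule x)
  ultimately show ?thesis using that[of l] \<open>n = k + r\<close> by simp
qed

section \<open>Subgradients, Lagrange multipliers and the perturbed variational inequality\<close>

definition subgradients :: "('a::euclidean_space \<Rightarrow> real) \<Rightarrow> 'a \<Rightarrow> 'a set" where
  "subgradients h x = {v. \<forall>z. h x + v \<bullet> (z - x) \<le> h z}"

text \<open>Minimality makes the strict epigraph of h disjoint from \<open>C\<close> times the ray
  up to h x. The slope of a separating hyperplane is the subgradient; since h is finite everywhere,
  the hyperplane cannot be vertical, whatever the shape of \<open>C\<close>.\<close>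

lemma convex_minimizer_subgradient:
  fixes h :: "'a::euclidean_space \<Rightarrow> real"
  assumes h: "convex_on UNIV h" and C: "convex C" "x \<in> C" and min: "\<And>z. z \<in> C \<Longrightarrow> h x \<le> h z"
  obtains v where "v \<in> subgradients h x" "\<And>z. z \<in> C \<Longrightarrow> 0 \<le> v \<bullet> (z - x)"
proof -
  define S where "S = {p. h (fst p) < snd p}"
  define T where "T = C \<times> {..h x}"
  have "convex S"
    unfolding convex_alt
  proof (intro ballI allI impI)
    fix p q :: "'a \<times> real" and u :: real
    assume "p \<in> S" "q \<in> S" and u: "0 \<le> u \<and> u \<le> 1"
    then have pq: "h (fst p) < snd p" "h (fst q) < snd q" by (auto simp: S_def)
    have "h ((1 - u) *\<^sub>R fst p + u *\<^sub>R fst q) \<le> (1 - u) * h (fst p) + u * h (fst q)"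
      using u by (intro convex_onD[OF h]) auto
    also have "\<dots> < (1 - u) * snd p + u * snd q"
    proof (cases "u = 0")
      case False
      then show ?thesis using u pq by (intro add_le_less_mono mult_left_mono mult_strict_left_mono) auto
    qed (use pq in simp)
    finally show "(1 - u) *\<^sub>R p + u *\<^sub>R q \<in> S" by (simp add: S_def)
  qed
  moreover have "convex T" using C(1) by (simp add: T_def convex_Times)
  moreover have "(x, h x + 1) \<in> S" "(x, h x) \<in> T" using C(2) by (auto simp: S_def T_def)
  moreover have "S \<inter> T = {}" using min by (fastforce simp: S_def T_def)
  ultimately obtain p b where pb: "p \<noteq> 0" "\<forall>y\<in>S. p \<bullet> y \<le> b" "\<forall>y\<in>T. b \<le> p \<bullet> y"
    using separating_hyperplane_sets[of S T] by blast
  obtain a r where p: "p = (a, r)" by fastforce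
  have S: "a \<bullet> z + r * t \<le> b" if "h z < t" for z t
    using pb(2) that by (auto simp: S_def p)
  have T: "b \<le> a \<bullet> z + r * h x" if "z \<in> C" for z
    using pb(3) that by (auto simp: T_def p)
  have S': "a \<bullet> z + r * h z \<le> b" for z
  proof (rule tendsto_upperbound)
    show "((\<lambda>t. a \<bullet> z + r * t) \<longlongrightarrow> a \<bullet> z + r * h z) (at_right (h z))"
      by (intro tendsto_intros)
    show "eventually (\<lambda>t. a \<bullet> z + r * t \<le> b) (at_right (h z))"
      using S by (auto simp: eventually_at_right_field intro!: exI[of _ "h z + 1"])
  qed auto
  have "r \<le> 0" using S[of x "h x + 1"] T[OF C(2)] by (simp add: algebra_simps)
  \<comment> \<open>A vertical hyperplane would bound the functional a on the whole space by its
    value at x; the point x + a refutes this.\<close>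
  moreover have "r \<noteq> 0"
  proof
    assume "r = 0"
    then have "a \<bullet> (x + a) \<le> a \<bullet> x" using S'[of "x + a"] T[OF C(2)] by simp
    then have "a \<bullet> a \<le> 0" by (simp only: inner_add_right add_le_same_cancel1)
    then have "a = 0" by (metis inner_gt_zero_iff not_less)
    then show False using pb(1) p \<open>r = 0\<close> by (simp add: zero_prod_def)
  qed
  ultimately have "r < 0" by simp
  show ?thesis
  proof (rule that[of "(- 1 / r) *\<^sub>R a"])
    show "(- 1 / r) *\<^sub>R a \<in> subgradients h x"
      unfolding subgradients_def
    proof safe
      fix z
      have "a \<bullet> (z - x) + r * (h z - h x) \<le> 0"
        using S'[of z] T[OF C(2)] by (simp add: algebra_simps)
      then have "0 \<le> (a \<bullet> (z - x) + r * (h z - h x)) / r"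
        using \<open>r < 0\<close> by (simp add: zero_le_divide_iff)
      then show "h x + (- 1 / r) *\<^sub>R a \<bullet> (z - x) \<le> h z"
        using \<open>r < 0\<close> by (simp add: add_divide_distrib)
    qed
    fix z assume "z \<in> C"
    then have "0 \<le> a \<bullet> (z - x)"
      using T[of z] S'[of x] by (simp add: inner_diff_right)
    then show "0 \<le> (- 1 / r) *\<^sub>R a \<bullet> (z - x)"
      using \<open>r < 0\<close> by (simp add: divide_le_0_iff)
  qed
qed

text \<open>Minimality on the slice gives a subgradient v whose negative is normal to the slice;
  splitting off the range of the adjoint yields the multiplier, and the subgradient inequality
  returns from v to h.\<close>

lemma lagrange_multiplier_exists:
  fixes h :: "'a::euclidean_space \<Rightarrow> real" and E :: "'a \<Rightarrow> 'n::euclidean_space"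
  assumes h: "convex_on UNIV h" and C: "polyhedron C" and E: "linear E" and x: "x \<in> C"
    and min: "\<And>z. z \<in> C \<Longrightarrow> E z = E x \<Longrightarrow> h x \<le> h z"
  obtains l where "\<And>z. z \<in> C \<Longrightarrow> 0 \<le> h z - h x - l \<bullet> E (z - x)"
proof -
  have "convex (E -` {E x})" using E by (intro convex_linear_vimage) auto
  then have "convex (C \<inter> E -` {E x})"
    using C by (intro convex_Int) (auto intro: polyhedron_imp_convex)
  then obtain v where v: "v \<in> subgradients h x"
    "\<And>z. z \<in> C \<inter> E -` {E x} \<Longrightarrow> 0 \<le> v \<bullet> (z - x)"
    using convex_minimizer_subgradient[OF h, of "C \<inter> E -` {E x}" x] x min by blast
  obtain l where l: "- v - adjoint E l \<in> normal_cone C x"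
    using multiplier_decomposition[OF C E x, of "- v"] v(2) by fastforce
  \<comment> \<open>The sign change adapts the decomposition to the convention in which the
    Lagrangian subtracts the multiplier term.\<close>
  show ?thesis
  proof (rule that[of "- l"])
    fix z assume "z \<in> C"
    then have "- v \<bullet> (z - x) - l \<bullet> E (z - x) \<le> 0"
      using l by (auto simp: normal_cone_def inner_diff_left adjoint_clauses[OF E])
    moreover have "h x + v \<bullet> (z - x) \<le> h z" using v(1) by (simp add: subgradients_def)
    ultimately show "0 \<le> h z - h x - (- l) \<bullet> E (z - x)" by simp
  qed
qed

text \<open>
  A solution of the variational inequality perturbed by \<open>(\<rho>, \<sigma>)\<close> lies near a solution of the
  unperturbed one: adding a subgradient as an auxiliary variable turns the perturbed solutions
  into points of a finite union of polyhedra on which \<open>(\<rho>, \<sigma>)\<close> is a linear function.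
\<close>

lemma perturbed_vi_error_bound:
  fixes h :: "'a::euclidean_space \<Rightarrow> real" and E :: "'a \<Rightarrow> 'n::euclidean_space"
  assumes h: "convex_on UNIV h" and C: "polyhedron C" and E: "linear E"
    and sub: "polyhedral_union {(x, v). v \<in> subgradients h x}"
  obtains \<kappa> where "0 < \<kappa>"
    "\<And>x l \<rho> \<sigma>. x \<in> C \<Longrightarrow> (\<And>z. z \<in> C \<Longrightarrow> 0 \<le> h z - h x - l \<bullet> E (z - x) + \<rho> \<bullet> (z - x))
      \<Longrightarrow> E x - \<sigma> = c \<Longrightarrow> norm (\<rho>, \<sigma>) < 1 / \<kappa> \<Longrightarrow>
      \<exists>x' l'. x' \<in> C \<and> E x' = c \<and> (\<forall>z\<in>C. 0 \<le> h z - h x' - l' \<bullet> E (z - x'))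
        \<and> norm ((x, l) - (x', l')) \<le> \<kappa> * norm (\<rho>, \<sigma>)"
proof -
  \<comment> \<open>The conditions are: v is a subgradient, stationarity holds modulo the normal
    cone of \<open>C\<close>, and the perturbed equation holds. The constant \<open>c\<close> is
    kept in a singleton so that the map remains linear.\<close>
  define \<Gamma> :: "('a \<times> 'n \<times> 'a \<times> 'a \<times> 'n) set" where
    "\<Gamma> = (\<lambda>(x, l, v, \<rho>, \<sigma>). (x, v)) -` {(x, v). v \<in> subgradients h x}
      \<inter> (\<lambda>(x, l, v, \<rho>, \<sigma>). (x, adjoint E l - \<rho> - v)) -` {(x, n). n \<in> normal_cone C x}
      \<inter> (\<lambda>(x, l, v, \<rho>, \<sigma>). E x - \<sigma>) -` {c}"
  have aE: "linear (adjoint E)" using E by (rule adjoint_linear)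
  have lin: "linear (\<lambda>(x::'a, l::'n, v::'a, \<rho>::'a, \<sigma>::'n). (x, v))"
    "linear (\<lambda>(x::'a, l::'n, v::'a, \<rho>::'a, \<sigma>::'n). (x, adjoint E l - \<rho> - v))"
    "linear (\<lambda>(x::'a, l::'n, v::'a, \<rho>::'a, \<sigma>::'n). E x - \<sigma>)"
    by (auto simp: linear_iff linear_add[OF aE] linear_scale[OF aE] linear_add[OF E] linear_scale[OF E]
        algebra_simps)
  have "polyhedral_union \<Gamma>"
    unfolding \<Gamma>_def
    by (intro polyhedral_union_Int polyhedral_union_linear_vimage[OF _ lin(1)]
        polyhedral_union_linear_vimage[OF _ lin(2)] polyhedral_union_linear_vimage[OF _ lin(3)]
        sub polyhedral_union_normal_cone[OF C] polyhedron_imp_polyhedral_union affine_imp_polyhedron)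
      auto
  moreover have "linear (\<lambda>(x::'a, l::'n, v::'a, \<rho>::'a, \<sigma>::'n). (\<rho>, \<sigma>))"
    by (auto simp: linear_iff)
  ultimately obtain \<kappa> where \<kappa>: "0 < \<kappa>"
    "\<And>p. p \<in> \<Gamma> \<Longrightarrow> norm ((\<lambda>(x, l, v, \<rho>, \<sigma>). (\<rho>, \<sigma>)) p) < 1 / \<kappa> \<Longrightarrow>
      \<exists>q\<in>\<Gamma>. (\<lambda>(x, l, v, \<rho>, \<sigma>). (\<rho>, \<sigma>)) q = 0
        \<and> norm (p - q) \<le> \<kappa> * norm ((\<lambda>(x, l, v, \<rho>, \<sigma>). (\<rho>, \<sigma>)) p)"
    by (rule polyhedral_union_local_error_bound) blast
  show ?thesis
  proof (rule that[OF \<kappa>(1)])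
    fix x l \<rho> \<sigma>
    assume x: "x \<in> C" and vi: "\<And>z. z \<in> C \<Longrightarrow> 0 \<le> h z - h x - l \<bullet> E (z - x) + \<rho> \<bullet> (z - x)"
      and \<sigma>: "E x - \<sigma> = c" and small: "norm (\<rho>, \<sigma>) < 1 / \<kappa>"
    \<comment> \<open>With the linear terms collected in \<open>u\<close>, the inequality says that
      h plus the functional \<open>u\<close> is minimal over \<open>C\<close> at x; subtracting
      \<open>u\<close> from a subgradient of the sum gives one of h.\<close>
    define u where "u = \<rho> - adjoint E l"
    have u: "u \<bullet> y = \<rho> \<bullet> y - l \<bullet> E y" for y
      by (simp add: u_def inner_diff_left adjoint_clauses[OF E])
    have "convex_on UNIV (\<lambda>z. h z + u \<bullet> z)"
    proof (rule convex_on_add[OF h])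
      show "convex_on UNIV (\<lambda>z. u \<bullet> z)"
        by (rule convex_onI) (auto simp: inner_add_right)
    qed
    moreover have "h x + u \<bullet> x \<le> h z + u \<bullet> z" if "z \<in> C" for z
      using vi[OF that] u[of "z - x"] by (simp add: inner_diff_right)
    ultimately obtain v' where v': "v' \<in> subgradients (\<lambda>z. h z + u \<bullet> z) x"
      "\<And>z. z \<in> C \<Longrightarrow> 0 \<le> v' \<bullet> (z - x)"
      using convex_minimizer_subgradient[of "\<lambda>z. h z + u \<bullet> z" C x] C x polyhedron_imp_convex by blast
    have "v' - u \<in> subgradients h x"
      using v'(1) by (auto simp: subgradients_def inner_diff_left inner_diff_right algebra_simps)
    moreover have "- v' \<in> normal_cone C x"
      using v'(2) x by (auto simp: normal_cone_def)
    then have "adjoint E l - \<rho> - (v' - u) \<in> normal_cone C x" by (simp add: u_def)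
    ultimately have "(x, l, v' - u, \<rho>, \<sigma>) \<in> \<Gamma>" using \<sigma> by (simp add: \<Gamma>_def)
    from \<kappa>(2)[OF this] small obtain x' l' v where
      q: "(x', l', v, 0, 0) \<in> \<Gamma>" "norm ((x, l, v' - u, \<rho>, \<sigma>) - (x', l', v, 0, 0)) \<le> \<kappa> * norm (\<rho>, \<sigma>)"
      by (auto simp: zero_prod_def)
    have "norm ((x, l) - (x', l')) \<le> norm ((x, l, v' - u, \<rho>, \<sigma>) - (x', l', v, 0, 0))"
      by (simp add: norm_Pair)
    with q(2) have "norm ((x, l) - (x', l')) \<le> \<kappa> * norm (\<rho>, \<sigma>)" by linarith
    moreover have "x' \<in> C" "E x' = c" using q(1) by (auto simp: \<Gamma>_def normal_cone_def)
    moreover have "0 \<le> h z - h x' - l' \<bullet> E (z - x')" if "z \<in> C" for z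
    proof -
      have "(adjoint E l' - v) \<bullet> (z - x') \<le> 0" "h x' + v \<bullet> (z - x') \<le> h z"
        using q(1) that by (auto simp: \<Gamma>_def normal_cone_def subgradients_def)
      then show ?thesis by (simp add: inner_diff_left adjoint_clauses[OF E])
    qed
    ultimately show "\<exists>x' l'. x' \<in> C \<and> E x' = c \<and> (\<forall>z\<in>C. 0 \<le> h z - h x' - l' \<bullet> E (z - x'))
        \<and> norm ((x, l) - (x', l')) \<le> \<kappa> * norm (\<rho>, \<sigma>)" by blast
  qed
qed

subsection \<open>Block decomposition\<close>

lemma linear_block: "linear (block b i)"
  by (rule linearI) (auto simp: block_def vec_eq_iff)

lemma block_in_block_space: "block b i x \<in> block_space b i"
  by (simp add: block_def block_space_def)

lemma block_eq_self: "x \<in> block_space b i \<Longrightarrow> block b i x = x"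
  by (simp add: block_def block_space_def vec_eq_iff)

lemma block_block: "block b i (block b j x) = (if i = j then block b i x else 0)"
  by (simp add: block_def vec_eq_iff)

lemma sum_block: "(\<Sum>i\<in>UNIV. block b i x) = x" for b :: "'m::finite \<Rightarrow> 'p::finite"
  by (simp add: block_def vec_eq_iff sum.delta)

lemma inner_block: "block b i x \<bullet> y = x \<bullet> block b i y"
  by (simp add: block_def inner_vec_def if_distrib if_distribR cong: if_cong)

lemma block_inner_block: "block b i x \<bullet> block b i y = x \<bullet> block b i y"
  by (simp add: inner_block block_block)

lemma inner_eq_sum_block: "(\<Sum>i\<in>UNIV. block b i x \<bullet> block b i y) = x \<bullet> y"
  for b :: "'m::finite \<Rightarrow> 'p::finite"
  by (simp add: block_inner_block inner_sum_right [symmetric] sum_block)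

lemma block_update_eq: "block_update b i x z = x - block b i x + block b i z"
  by (simp add: block_update_def block_def vec_eq_iff)

lemma block_block_update: "block b l (block_update b i x z) = (if l = i then block b i z else block b l x)"
  by (simp add: block_update_def block_def vec_eq_iff)

lemma col_block_mult: "col_block b i A *v x = A *v block b i x"
  by (simp add: col_block_def block_def vec_eq_iff matrix_vector_mult_def if_distrib if_distribR
      cong: if_cong)

lemma subspace_block_space: "subspace (block_space b i)"
  by (auto simp: block_space_def subspace_def)

lemma sum_mult_block: "(\<Sum>i\<in>UNIV. A *v block b i x) = A *v x" for b :: "'m::finite \<Rightarrow> 'p::finite"
  by (simp add: linear_sum[OF matrix_vector_mul_linear, symmetric, unfolded o_def] sum_block)

lemma polyhedron_block_product:
  fixes b :: "'m::finite \<Rightarrow> 'p::finite"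
  assumes "\<And>i. polyhedron (X i)"
  shows "polyhedron (block_product b X)"
proof -
  have "block_product b X = (\<Inter>i. block b i -` X i)" by (auto simp: block_product_def)
  also have "polyhedron \<dots>"
    by (intro polyhedron_Inter) (auto intro: polyhedron_linear_vimage[OF assms linear_block])
  finally show ?thesis .
qed

lemma convex_on_linear_compose:
  assumes "convex_on V f" "linear L" "range L \<subseteq> V"
  shows "convex_on UNIV (\<lambda>x. f (L x))"
proof (rule convex_onI)
  fix t :: real and x y assume "0 < t" "t < 1"
  then show "f (L ((1 - t) *\<^sub>R x + t *\<^sub>R y)) \<le> (1 - t) * f (L x) + t * f (L y)"
    using convex_onD[OF assms(1), of t "L x" "L y"] assms(3)
    by (auto simp: linear_add[OF assms(2)] linear_scale[OF assms(2)])
qed auto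

lemma convex_on_sum_block:
  fixes b :: "'m::finite \<Rightarrow> 'p::finite"
  assumes "\<And>i. convex_on (block_space b i) (f i)"
  shows "convex_on UNIV (\<lambda>x. \<Sum>i\<in>UNIV. f i (block b i x))"
proof -
  have conv: "convex_on UNIV (\<lambda>x. f i (block b i x))" for i
    using assms linear_block by (rule convex_on_linear_compose) (auto simp: block_in_block_space)
  have "convex_on UNIV (\<lambda>x. \<Sum>i\<in>S. f i (block b i x))" if "finite S" for S
    using that
  proof (induction S rule: finite_induct)
    case (insert i S)
    then show ?case using convex_on_add[OF conv insert.IH] by simp
  qed (simp add: convex_on_const)
  then show ?thesis by simp
qed

text \<open>Blocks vary independently: testing with a point that differs from x in block i alone
  cancels all other terms, and summing the block inequalities gives the converse.\<close>

lemma subgradients_sum_block: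
  fixes b :: "'m::finite \<Rightarrow> 'p::finite"
  shows "v \<in> subgradients (\<lambda>x. \<Sum>i\<in>UNIV. f i (block b i x)) x \<longleftrightarrow>
    (\<forall>i. block b i v \<in> subdiff_on (block_space b i) (f i) (block b i x))"
proof (intro iffI allI)
  fix i assume v: "v \<in> subgradients (\<lambda>x. \<Sum>i\<in>UNIV. f i (block b i x)) x"
  have "f i (block b i x) + block b i v \<bullet> (z - block b i x) \<le> f i z" if "z \<in> block_space b i" for z
  proof -
    have split: "(\<Sum>l\<in>UNIV. F l) = F i + (\<Sum>l\<in>UNIV - {i}. F l)" for F :: "'p \<Rightarrow> real"
      by (subst sum.remove[of _ i]) auto
    have "(\<Sum>l\<in>UNIV. f l (block b l x)) + v \<bullet> (block_update b i x z - x)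
        \<le> (\<Sum>l\<in>UNIV. f l (block b l (block_update b i x z)))"
      using v by (simp add: subgradients_def)
    then have "f i (block b i x) + v \<bullet> (block_update b i x z - x) \<le> f i z"
      unfolding split using block_eq_self[OF that] by (simp add: block_block_update)
    moreover have "v \<bullet> (block_update b i x z - x) = block b i v \<bullet> (z - block b i x)"
      using block_eq_self[OF that]
      by (simp add: block_update_eq inner_block inner_diff_right block_block linear_diff[OF linear_block])
    ultimately show ?thesis by simp
  qed
  then show "block b i v \<in> subdiff_on (block_space b i) (f i) (block b i x)"
    by (simp add: subdiff_on_def block_in_block_space)
next
  assume v: "\<forall>i. block b i v \<in> subdiff_on (block_space b i) (f i) (block b i x)"
  have "(\<Sum>i\<in>UNIV. f i (block b i x)) + v \<bullet> (z - x) \<le> (\<Sum>i\<in>UNIV. f i (block b i z))" for z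
  proof -
    have "(\<Sum>i\<in>UNIV. f i (block b i x)) + v \<bullet> (z - x)
        = (\<Sum>i\<in>UNIV. f i (block b i x) + block b i v \<bullet> (block b i z - block b i x))"
      by (simp add: sum.distrib linear_diff[OF linear_block, symmetric] inner_eq_sum_block)
    also have "\<dots> \<le> (\<Sum>i\<in>UNIV. f i (block b i z))"
      using v by (intro sum_mono) (simp add: subdiff_on_def block_in_block_space)
    finally show ?thesis .
  qed
  then show "v \<in> subgradients (\<lambda>x. \<Sum>i\<in>UNIV. f i (block b i x)) x"
    by (simp add: subgradients_def)
qed

lemma polyhedral_union_subgradients_sum_block:
  fixes b :: "'m::finite \<Rightarrow> 'p::finite"
  assumes "\<And>i. piecewise_linear_mf (subdiff_on (block_space b i) (f i))"
  shows "polyhedral_union {(x, v). v \<in> subgradients (\<lambda>x. \<Sum>i\<in>UNIV. f i (block b i x)) x}"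
proof -
  have lin: "linear (\<lambda>(x, v). (block b i x, block b i v))" for i
    by (auto simp: linear_iff linear_add[OF linear_block] linear_scale[OF linear_block])
  have "{(x, v). v \<in> subgradients (\<lambda>x. \<Sum>i\<in>UNIV. f i (block b i x)) x}
      = (\<Inter>i. (\<lambda>(x, v). (block b i x, block b i v)) -`
          {(x, v). v \<in> subdiff_on (block_space b i) (f i) x})"
    by (auto simp: subgradients_sum_block)
  also have "polyhedral_union \<dots>"
    using assms by (intro polyhedral_union_INT polyhedral_union_linear_vimage[OF _ lin])
      (auto simp: piecewise_linear_mf_def polyhedral_union_def)
  finally show ?thesis .
qed

lemma subgradients_separable:
  "(v, w) \<in> subgradients (\<lambda>u. F (fst u) + G (snd u)) (x, y) \<longleftrightarrow>
    v \<in> subgradients F x \<and> w \<in> subgradients G y"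
proof safe
  assume *: "(v, w) \<in> subgradients (\<lambda>u. F (fst u) + G (snd u)) (x, y)"
  have **: "F x + G y + (v \<bullet> (z - x) + w \<bullet> (z' - y)) \<le> F z + G z'" for z z'
    using * by (auto simp: subgradients_def dest: spec[of _ "(z, z')"])
  show "v \<in> subgradients F x"
    unfolding subgradients_def using **[of _ y] by auto
  show "w \<in> subgradients G y"
    unfolding subgradients_def using **[of x] by auto
next
  assume vw: "v \<in> subgradients F x" "w \<in> subgradients G y"
  have "F x + G y + (v, w) \<bullet> ((z, z') - (x, y)) \<le> F z + G z'" for z z'
  proof -
    have "F x + v \<bullet> (z - x) \<le> F z" "G y + w \<bullet> (z' - y) \<le> G z'"
      using vw by (auto simp: subgradients_def)
    then show ?thesis by simp
  qed
  then show "(v, w) \<in> subgradients (\<lambda>u. F (fst u) + G (snd u)) (x, y)"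
    by (simp add: subgradients_def)
qed

lemma polyhedral_union_subgradients_objective:
  fixes bx :: "'m::finite \<Rightarrow> 'p::finite" and bd :: "'d::finite \<Rightarrow> 'q::finite"
  assumes "\<And>i. piecewise_linear_mf (subdiff_on (block_space bx i) (f i))"
    and "\<And>j. piecewise_linear_mf (subdiff_on (block_space bd j) (g j))"
  shows "polyhedral_union {(u, v). v \<in> subgradients (\<lambda>u. objective bx bd f g (fst u) (snd u)) u}"
proof -
  let ?F = "\<lambda>x. \<Sum>i\<in>UNIV. f i (block bx i x)" and ?G = "\<lambda>y. \<Sum>j\<in>UNIV. g j (block bd j y)"
  have lin: "linear (\<lambda>((x :: real ^ 'm, y :: real ^ 'd), (v :: real ^ 'm, w :: real ^ 'd)). (x, v))"
    "linear (\<lambda>((x :: real ^ 'm, y :: real ^ 'd), (v :: real ^ 'm, w :: real ^ 'd)). (y, w))"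
    by (auto simp: linear_iff)
  have "{(u, v). v \<in> subgradients (\<lambda>u. objective bx bd f g (fst u) (snd u)) u}
      = (\<lambda>((x, y), (v, w)). (x, v)) -` {(x, v). v \<in> subgradients ?F x}
        \<inter> (\<lambda>((x, y), (v, w)). (y, w)) -` {(x, v). v \<in> subgradients ?G x}"
    unfolding objective_def
    by (auto simp: subgradients_separable[where F = ?F and G = ?G])
  also have "polyhedral_union \<dots>"
    by (intro polyhedral_union_Int polyhedral_union_linear_vimage[OF _ lin(1)]
        polyhedral_union_linear_vimage[OF _ lin(2)] polyhedral_union_subgradients_sum_block assms)
  finally show ?thesis .
qed

lemma convex_on_objective:
  fixes bx :: "'m::finite \<Rightarrow> 'p::finite" and bd :: "'d::finite \<Rightarrow> 'q::finite"
  assumes "\<And>i. convex_on (block_space bx i) (f i)" and "\<And>j. convex_on (block_space bd j) (g j)"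
  shows "convex_on UNIV (\<lambda>u. objective bx bd f g (fst u) (snd u))"
  unfolding objective_def
  using convex_on_linear_compose[OF convex_on_sum_block[OF assms(1)] linear_fst]
    convex_on_linear_compose[OF convex_on_sum_block[OF assms(2)] linear_snd]
  by (intro convex_on_add) auto

text \<open>Padding by zero columns leaves the range unchanged, so full column rank says that
  \<open>A\<close> maps a basis of the block space to a spanning set whose size equals its
  dimension, hence to an independent family.\<close>

lemma full_rank_col_block_injective:
  fixes A :: "real ^ 'm::finite ^ 'n::finite" and b :: "'m \<Rightarrow> 'p"
  assumes rank: "rank (col_block b i A) = block_dim b i"
    and x: "x \<in> block_space b i" and Ax: "A *v x = 0"
  shows "x = 0"
proof -
  have dimV: "dim (block_space b i) = block_dim b i"
    using dim_substandard_cart[where d = "{k. b k = i}" and 'a = real, unfolded dim_vec_eq]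
    by (simp add: block_space_def block_dim_def)
  have range: "range (\<lambda>x. col_block b i A *v x) = (\<lambda>x. A *v x) ` block_space b i"
  proof
    show "range ((*v) (col_block b i A)) \<subseteq> (*v) A ` block_space b i"
      by (auto simp: col_block_mult block_in_block_space)
    show "(*v) A ` block_space b i \<subseteq> range ((*v) (col_block b i A))"
    proof
      fix y assume "y \<in> (*v) A ` block_space b i"
      then obtain x where "x \<in> block_space b i" "y = A *v x" by blast
      then have "y = col_block b i A *v x" by (simp add: col_block_mult block_eq_self)
      then show "y \<in> range ((*v) (col_block b i A))" by blast
    qed
  qed
  obtain S where S: "S \<subseteq> block_space b i" "independent S" "block_space b i \<subseteq> span S"
    "card S = dim (block_space b i)"
    using basis_exists by blast
  have span: "span S = block_space b i"
    using S(1,3) subspace_block_space by (metis span_subspace)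
  have fin: "finite S" using S(2) by (rule independent_imp_finite)
  have "independent ((*v) A ` S) \<and> inj_on ((*v) A) S"
  proof -
    have "dim ((*v) A ` S) = dim (span ((*v) A ` S))" by simp
    also have "span ((*v) A ` S) = (*v) A ` block_space b i"
      using span by (simp add: linear_span_image[OF matrix_vector_mul_linear])
    also have "dim \<dots> = card S"
      using rank dimV S(4) by (simp add: rank_dim_range range)
    finally have dim: "dim ((*v) A ` S) = card S" .
    have "card ((*v) A ` S) \<le> card S" by (rule card_image_le[OF fin])
    moreover have "dim ((*v) A ` S) \<le> card ((*v) A ` S)"
      by (rule dim_le_card') (use fin in auto)
    ultimately have card: "card ((*v) A ` S) = card S" using dim by simp
    then have "inj_on ((*v) A) S" using fin by (simp add: eq_card_imp_inj_on)
    moreover have "independent ((*v) A ` S)"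
      using fin dim card by (intro card_le_dim_spanning[of _ "span ((*v) A ` S)"]) (auto simp: span_superset)
    ultimately show ?thesis by blast
  qed
  then have "inj_on ((*v) A) (span S)"
    using linear_inj_on_span_independent_image[OF matrix_vector_mul_linear, of A S] by blast
  then show ?thesis
    using x Ax span inj_onD[of "(*v) A" "span S" x 0] span_zero[of S] by simp
qed

subsection \<open>The block matrices of the algorithm\<close>

lemma parts_stack [simp]:
  "x_part (stack x y l) = x" "y_part (stack x y l) = y" "l_part (stack x y l) = l"
  by (simp_all add: x_part_def y_part_def l_part_def stack_def vec_eq_iff)

lemma sum_UNIV_triple:
  fixes F :: "'m::finite + 'd::finite + 'n::finite \<Rightarrow> real"
  shows "(\<Sum>k\<in>UNIV. F k) = (\<Sum>a\<in>UNIV. F (Inl a)) + (\<Sum>b\<in>UNIV. F (Inr (Inl b))) + (\<Sum>r\<in>UNIV. F (Inr (Inr r)))"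
  by (simp add: UNIV_sum[symmetric] sum.Plus flip: UNIV_Plus_UNIV)

lemma inner_triple:
  fixes w w' :: "real ^ ('m::finite + 'd::finite + 'n::finite)"
  shows "w \<bullet> w' = x_part w \<bullet> x_part w' + y_part w \<bullet> y_part w' + l_part w \<bullet> l_part w'"
  by (simp add: inner_vec_def sum_UNIV_triple x_part_def y_part_def l_part_def)

lemma triple_eq_iff: "w = w' \<longleftrightarrow> x_part w = x_part w' \<and> y_part w = y_part w' \<and> l_part w = l_part w'"
  by (auto simp: vec_eq_iff x_part_def y_part_def l_part_def split_sum_all)

lemma parts_linear [simp]:
  "x_part (w + w') = x_part w + x_part w'" "y_part (w + w') = y_part w + y_part w'"
  "l_part (w + w') = l_part w + l_part w'"
  "x_part (w - w') = x_part w - x_part w'" "y_part (w - w') = y_part w - y_part w'"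
  "l_part (w - w') = l_part w - l_part w'"
  "x_part 0 = 0" "y_part 0 = 0" "l_part 0 = 0"
  by (simp_all add: x_part_def y_part_def l_part_def vec_eq_iff)

lemma norm_triple:
  fixes w :: "real ^ ('m::finite + 'd::finite + 'n::finite)"
  shows "norm w = norm ((x_part w, y_part w), l_part w)"
proof -
  have "norm w = sqrt (w \<bullet> w)" by (rule norm_eq_sqrt_inner)
  also have "w \<bullet> w = ((x_part w, y_part w), l_part w) \<bullet> ((x_part w, y_part w), l_part w)"
    by (simp add: inner_triple)
  finally show ?thesis by (simp only: norm_eq_sqrt_inner)
qed

lemma block_matrix3_mult:
  "x_part (block_matrix3 xx xy xl yx yy yl lx ly ll *v w) = xx *v x_part w + xy *v y_part w + xl *v l_part w"
  "y_part (block_matrix3 xx xy xl yx yy yl lx ly ll *v w) = yx *v x_part w + yy *v y_part w + yl *v l_part w"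
  "l_part (block_matrix3 xx xy xl yx yy yl lx ly ll *v w) = lx *v x_part w + ly *v y_part w + ll *v l_part w"
proof -
  have row: "(\<Sum>k\<in>UNIV. v $ k * u $ k) = v \<bullet> u" for u v :: "real ^ 'k::finite"
    by (simp add: inner_vec_def)
  show "x_part (block_matrix3 xx xy xl yx yy yl lx ly ll *v w) = xx *v x_part w + xy *v y_part w + xl *v l_part w"
    "y_part (block_matrix3 xx xy xl yx yy yl lx ly ll *v w) = yx *v x_part w + yy *v y_part w + yl *v l_part w"
    "l_part (block_matrix3 xx xy xl yx yy yl lx ly ll *v w) = lx *v x_part w + ly *v y_part w + ll *v l_part w"
    by (auto simp: vec_eq_iff block_matrix3_def matrix_vector_mult_def x_part_def[of "vec_lambda _"]
        y_part_def[of "vec_lambda _"] l_part_def[of "vec_lambda _"] row inner_triple[of "stack _ _ _"])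
qed

lemma inner_transpose_mult: "x \<bullet> (transpose A *v y) = (A *v x) \<bullet> y" for A :: "real ^ 'm::finite ^ 'n::finite"
  by (metis dot_lmul_matrix inner_commute transpose_matrix_vector)

lemma inner_vector_matrix_mult: "x \<bullet> (y v* A) = (A *v x) \<bullet> y" for A :: "real ^ 'm::finite ^ 'n::finite"
  by (metis dot_lmul_matrix inner_commute)

lemma scaleR_matrix_mult: "(r *\<^sub>R A) *v x = r *\<^sub>R (A *v x)" for A :: "real ^ 'm::finite ^ 'n::finite"
  by (rule scaleR_matrix_vector_assoc [symmetric])

lemma uminus_matrix_mult: "(- A) *v x = - (A *v x)" for A :: "real ^ 'm::finite ^ 'n::finite"
  using scaleR_matrix_mult[of "-1" A x] by simp

lemma sum_matrix_mult: "(\<Sum>i\<in>S. F i) *v x = (\<Sum>i\<in>S. F i *v x)"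
  for F :: "'i \<Rightarrow> real ^ 'm::finite ^ 'n::finite"
  by (induction S rule: infinite_finite_induct) (auto simp: matrix_vector_mult_add_rdistrib)

section \<open>Block Gram forms and the positivity of the constants\<close>

definition block_form ::
    "('m::finite \<Rightarrow> 'p::finite) \<Rightarrow> real ^ 'm ^ 'n::finite \<Rightarrow> real ^ 'm \<Rightarrow> real ^ 'm \<Rightarrow> real" where
  "block_form b A x' x = (\<Sum>i\<in>UNIV. (A *v block b i x') \<bullet> (A *v block b i x))"

lemma block_form_commute: "block_form b A x y = block_form b A y x"
  by (simp add: block_form_def inner_commute)

lemma inner_gram_blocks:
  "x' \<bullet> ((transpose (col_block b i A) ** col_block b l A) *v x) = (A *v block b i x') \<bullet> (A *v block b l x)"
  by (simp only: inner_transpose_mult col_block_mult matrix_vector_mul_assoc [symmetric])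

text \<open>\<open>block_form\<close> is the bilinear form of D = diag(\<open>A_i^T A_i\<close>),
  and completing the off-diagonal blocks by the diagonal ones writes \<open>Hx_mat\<close> as (1 +
  \<sigma>1) \<beta> D - \<beta> \<open>A^T A\<close>. Its definiteness thus becomes a comparison of
  \<open>A^T A\<close> with D.\<close>

lemma inner_Hx_mat:
  fixes bx :: "'m::finite \<Rightarrow> 'p::finite"
  shows "x' \<bullet> (Hx_mat bx A \<beta> \<sigma>1 *v x)
    = (1 + \<sigma>1) * \<beta> * block_form bx A x' x - \<beta> * ((A *v x') \<bullet> (A *v x))"
proof -
  let ?a = "\<lambda>i l. (A *v block bx i x') \<bullet> (A *v block bx l x)"
  have "x' \<bullet> (Hx_mat bx A \<beta> \<sigma>1 *v x) = (\<Sum>i\<in>UNIV. \<Sum>l\<in>UNIV. (if i = l then \<sigma>1 * \<beta> else - \<beta>) * ?a i l)"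
    by (simp add: Hx_mat_def sum_matrix_mult scaleR_matrix_mult inner_sum_right inner_gram_blocks)
  also have "\<dots> = (\<Sum>i\<in>UNIV. \<Sum>l\<in>UNIV. (if i = l then (1 + \<sigma>1) * \<beta> * ?a i l else 0) - \<beta> * ?a i l)"
    by (intro sum.cong refl) (auto simp: algebra_simps)
  also have "\<dots> = (1 + \<sigma>1) * \<beta> * block_form bx A x' x - \<beta> * (\<Sum>i\<in>UNIV. \<Sum>l\<in>UNIV. ?a i l)"
    by (simp add: sum_subtractf sum.delta sum_distrib_left block_form_def)
  also have "(\<Sum>i\<in>UNIV. \<Sum>l\<in>UNIV. ?a i l) = (A *v x') \<bullet> (A *v x)"
    by (simp add: inner_sum_right [symmetric] inner_sum_left [symmetric] sum_mult_block)
  finally show ?thesis .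
qed

lemma inner_DB_mat: "y' \<bullet> (DB_mat bd B *v y) = block_form bd B y' y"
  by (simp add: DB_mat_def sum_matrix_mult inner_sum_right inner_gram_blocks block_form_def)

lemma norm_sum_squared_le:
  fixes a :: "'i::finite \<Rightarrow> 'a::real_normed_vector"
  shows "(norm (\<Sum>i\<in>UNIV. a i))\<^sup>2 \<le> real CARD('i) * (\<Sum>i\<in>UNIV. (norm (a i))\<^sup>2)"
proof -
  have "(norm (\<Sum>i\<in>UNIV. a i))\<^sup>2 \<le> (\<Sum>i\<in>UNIV. norm (a i))\<^sup>2"
    by (intro power_mono norm_sum) auto
  also have "\<dots> \<le> real CARD('i) * (\<Sum>i\<in>UNIV. (norm (a i))\<^sup>2)"
    using sum_squared_le_sum_of_squares[of "\<lambda>i. norm (a i)" UNIV] by (simp add: mult.commute)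
  finally show ?thesis .
qed

lemma block_form_nonneg: "0 \<le> block_form b A x x"
  by (simp add: block_form_def sum_nonneg)

lemma block_form_pos:
  fixes b :: "'m::finite \<Rightarrow> 'p::finite"
  assumes rank: "\<And>i. rank (col_block b i A) = block_dim b i" and "x \<noteq> 0"
  shows "0 < block_form b A x x"
proof (rule ccontr)
  assume "\<not> 0 < block_form b A x x"
  then have "block_form b A x x = 0" using block_form_nonneg[of b A x] by simp
  then have "A *v block b i x = 0" for i
    by (simp add: block_form_def sum_nonneg_eq_0_iff)
  then have "block b i x = 0" for i
    by (intro full_rank_col_block_injective[OF rank block_in_block_space])
  then have "x = 0" using sum_block[of b x] by simp
  with \<open>x \<noteq> 0\<close> show False by simp
qed

text \<open>Cauchy-Schwarz for a sum with one term per block. This is where the thresholds p - 1 and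
  q - 1 for \<sigma>1 and \<sigma>2 come from: r will be 1 + \<sigma>1 or \<sigma>2 + 1.\<close>

lemma block_form_excess_nonneg:
  fixes b :: "'m::finite \<Rightarrow> 'p::finite"
  assumes "real CARD('p) \<le> r"
  shows "(A *v x) \<bullet> (A *v x) \<le> r * block_form b A x x"
proof -
  have "(A *v x) \<bullet> (A *v x) \<le> real CARD('p) * block_form b A x x"
    using norm_sum_squared_le[of "\<lambda>i. A *v block b i x"]
    by (simp add: sum_mult_block block_form_def power2_norm_eq_inner)
  also have "\<dots> \<le> r * block_form b A x x"
    using assms block_form_nonneg by (intro mult_right_mono)
  finally show ?thesis .
qed

lemma block_form_excess_pos:
  fixes b :: "'m::finite \<Rightarrow> 'p::finite"
  assumes "real CARD('p) < r" and rank: "\<And>i. rank (col_block b i A) = block_dim b i" and "x \<noteq> 0"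
  shows "(A *v x) \<bullet> (A *v x) < r * block_form b A x x"
proof -
  have "(A *v x) \<bullet> (A *v x) \<le> real CARD('p) * block_form b A x x"
    by (intro block_form_excess_nonneg) simp
  also have "\<dots> < r * block_form b A x x"
    using assms by (intro mult_strict_right_mono block_form_pos)
  finally show ?thesis .
qed

text \<open>Surjectivity of the block map gives block i a coordinate, so the spectrum is nonempty
  and \<open>Max\<close> is a genuine eigenvalue of a positive semidefinite matrix.\<close>

lemma gram_max_nonneg:
  fixes b :: "'m::finite \<Rightarrow> 'p" and A :: "real ^ 'm ^ 'n::finite"
  assumes "surj b"
  shows "0 \<le> gram_max b i A"
proof -
  let ?S = "transpose (col_block b i A) ** col_block b i A"
  obtain k where k: "b k = i" using assms by (metis surjD)
  have sym: "x \<bullet> (?S *v y) = y \<bullet> (?S *v x)" for x y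
    by (simp add: inner_gram_blocks inner_commute)
  have "transpose (col_block b i A) *v z \<in> block_space b i" for z
    unfolding block_space_def col_block_def transpose_def matrix_vector_mult_def by simp
  then have "?S *v x \<in> block_space b i" for x
    by (simp only: matrix_vector_mul_assoc [symmetric])
  moreover have "axis k 1 \<in> block_space b i" "axis k 1 \<noteq> (0 :: real ^ 'm)"
    using k by (auto simp: block_space_def axis_def vec_eq_iff)
  ultimately have "eigenvalues_on (block_space b i) ?S \<noteq> {}"
    by (intro symmetric_eigenvalues_on_nonempty[OF sym subspace_block_space])
  then have "gram_max b i A \<in> eigenvalues_on (block_space b i) ?S"
    unfolding gram_max_def lambda_max_on_def
    by (intro Max_in finite_symmetric_eigenvalues_on[OF sym])
  then show ?thesis by (rule eigenvalue_nonneg) (simp add: inner_gram_blocks)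
qed

text \<open>The summand 2 / \<beta>^2 of \<open>eta_bar\<close> is strictly positive and all others
  are nonnegative.\<close>

lemma delta_const_pos:
  fixes bx :: "'m::finite \<Rightarrow> 'p::finite" and bd :: "'d::finite \<Rightarrow> 'q::finite"
  assumes "surj bx" "surj bd" "0 < \<beta>"
  shows "0 < delta_const bx bd A B \<beta> \<sigma>1 \<sigma>2 \<tau> s"
proof -
  have "0 < eta_bar bx bd A B \<beta> \<tau> s"
    unfolding eta_bar_def
    using assms by (intro add_nonneg_pos add_nonneg_nonneg mult_nonneg_nonneg sum_nonneg gram_max_nonneg) auto
  also have "\<dots> \<le> delta_const bx bd A B \<beta> \<sigma>1 \<sigma>2 \<tau> s"
    unfolding delta_const_def by (intro Max_ge) auto
  finally show ?thesis .
qed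

section \<open>Symmetry and positive definiteness of H and G\<close>

locale gs_admm_matrices =
  fixes bx :: "'m::finite \<Rightarrow> 'p::finite" and bd :: "'d::finite \<Rightarrow> 'q::finite"
    and A :: "real ^ 'm ^ 'n::finite" and B :: "real ^ 'd ^ 'n"
    and \<beta> \<sigma>1 \<sigma>2 \<tau> s :: real
  assumes rank_A: "\<And>i. rank (col_block bx i A) = block_dim bx i"
    and rank_B: "\<And>j. rank (col_block bd j B) = block_dim bd j"
    and \<beta>: "0 < \<beta>" and \<sigma>1: "real CARD('p) - 1 < \<sigma>1" and \<sigma>2: "real CARD('q) - 1 < \<sigma>2"
    and \<tau>: "\<tau> < 1" and s: "s < 1" and \<tau>s: "0 < \<tau> + s"
begin

definition Qm where "Qm = Q_mat bx bd A B \<beta> \<sigma>1 \<sigma>2 \<tau>"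
definition Mm :: "real ^ ('m + 'd + 'n) ^ ('m + 'd + 'n)" where "Mm = M_mat B \<beta> \<tau> s"
definition Hm where "Hm = H_mat bx bd A B \<beta> \<sigma>1 \<sigma>2 \<tau> s"
definition Gm where "Gm = G_mat bx bd A B \<beta> \<sigma>1 \<sigma>2 \<tau> s"

lemma Q_parts:
  "x_part (Qm *v w) = Hx_mat bx A \<beta> \<sigma>1 *v x_part w"
  "y_part (Qm *v w) = ((\<sigma>2 + 1) * \<beta>) *\<^sub>R (DB_mat bd B *v y_part w) - \<tau> *\<^sub>R (transpose B *v l_part w)"
  "l_part (Qm *v w) = (1 / \<beta>) *\<^sub>R l_part w - B *v y_part w"
  by (simp_all add: Qm_def Q_mat_def block_matrix3_mult scaleR_matrix_mult uminus_matrix_mult)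

lemma M_parts:
  "x_part (Mm *v w) = x_part w" "y_part (Mm *v w) = y_part w"
  "l_part (Mm *v w) = (\<tau> + s) *\<^sub>R l_part w - (s * \<beta>) *\<^sub>R (B *v y_part w)"
  by (simp_all add: Mm_def M_mat_def block_matrix3_mult scaleR_matrix_mult uminus_matrix_mult)

text \<open>\<open>Mm\<close> is block triangular with diagonal blocks I, I and (\<tau> + s) I,
  hence invertible. Through this identity and surjectivity of \<open>Mm\<close>, facts about H are
  read off from Q and M without a formula for H.\<close>

lemma H_M: "Hm *v (Mm *v w) = Qm *v w"
proof -
  have "w = 0" if "Mm *v w = 0" for w
  proof -
    have "x_part w = 0" "y_part w = 0" "(\<tau> + s) *\<^sub>R l_part w - (s * \<beta>) *\<^sub>R (B *v y_part w) = 0"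
      using that M_parts[of w] by simp_all
    then show "w = 0" using \<tau>s by (simp add: triple_eq_iff)
  qed
  then have "invertible Mm"
    by (simp add: invertible_left_inverse matrix_left_invertible_ker)
  then have "matrix_inv Mm ** Mm = mat 1"
    unfolding matrix_inv_def invertible_def by (rule someI2_ex) blast
  then have "Hm ** Mm = Qm"
    by (simp add: Hm_def H_mat_def Mm_def Qm_def flip: matrix_mul_assoc)
  then show ?thesis by (simp add: matrix_vector_mul_assoc)
qed

lemma M_surj: "\<exists>w. z = Mm *v w"
proof
  let ?l = "(1 / (\<tau> + s)) *\<^sub>R (l_part z + (s * \<beta>) *\<^sub>R (B *v y_part z))"
  show "z = Mm *v stack (x_part z) (y_part z) ?l"
    using \<tau>s by (simp add: triple_eq_iff M_parts)
qed

definition x_form where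
  "x_form x' x = (1 + \<sigma>1) * \<beta> * block_form bx A x' x - \<beta> * ((A *v x') \<bullet> (A *v x))"

lemma x_form_commute: "x_form x x' = x_form x' x"
  by (simp add: x_form_def block_form_commute inner_commute)

lemma Q_form:
  "w' \<bullet> (Qm *v w) = x_form (x_part w') (x_part w) + (\<sigma>2 + 1) * \<beta> * block_form bd B (y_part w') (y_part w)
    - \<tau> * ((B *v y_part w') \<bullet> l_part w) - l_part w' \<bullet> (B *v y_part w) + (l_part w' \<bullet> l_part w) / \<beta>"
  by (simp add: inner_triple Q_parts inner_Hx_mat inner_DB_mat x_form_def inner_diff_right
      inner_vector_matrix_mult)

text \<open>This is the form of H in the coordinates z = M w, and the formula displays its
  symmetry.\<close>

lemma MQ_form:
  "(Mm *v w') \<bullet> (Qm *v w) = x_form (x_part w') (x_part w)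
    + (\<sigma>2 + 1) * \<beta> * block_form bd B (y_part w') (y_part w)
    + s * \<beta> * ((B *v y_part w') \<bullet> (B *v y_part w))
    - (\<tau> + s) * ((B *v y_part w') \<bullet> l_part w + l_part w' \<bullet> (B *v y_part w))
    + (\<tau> + s) / \<beta> * (l_part w' \<bullet> l_part w)"
  unfolding Q_form M_parts inner_diff_left inner_scaleR_left
  using \<beta> by (simp add: field_simps)

lemma G_form: "w' \<bullet> (Gm *v w) = w' \<bullet> (Qm *v w) + w \<bullet> (Qm *v w') - (Mm *v w') \<bullet> (Qm *v w)"
  by (simp add: Gm_def G_mat_def Qm_def Mm_def matrix_vector_mult_add_rdistrib
      matrix_vector_mult_diff_rdistrib inner_add_right inner_diff_right inner_vector_matrix_mult
      inner_commute flip: matrix_vector_mul_assoc)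

lemma MQ_form_commute: "(Mm *v w') \<bullet> (Qm *v w) = (Mm *v w) \<bullet> (Qm *v w')"
  unfolding MQ_form by (simp add: x_form_commute block_form_commute inner_commute)

lemma H_symmetric: "z' \<bullet> (Hm *v z) = z \<bullet> (Hm *v z')"
proof -
  obtain w w' where "z = Mm *v w" "z' = Mm *v w'" using M_surj by blast
  then show ?thesis by (simp add: H_M MQ_form_commute)
qed

lemma G_symmetric: "w' \<bullet> (Gm *v w) = w \<bullet> (Gm *v w')"
  using MQ_form_commute[of w w'] by (simp add: G_form)

lemma x_form_nonneg: "0 \<le> x_form x x"
  using mult_left_mono[OF block_form_excess_nonneg[of "1 + \<sigma>1" A x bx], of \<beta>] \<sigma>1 \<beta>
  by (simp add: x_form_def algebra_simps)

lemma x_form_pos: "x \<noteq> 0 \<Longrightarrow> 0 < x_form x x"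
  using mult_strict_left_mono[OF block_form_excess_pos[OF _ rank_A, of "1 + \<sigma>1" x], of \<beta>] \<sigma>1 \<beta>
  by (simp add: x_form_def algebra_simps)

text \<open>Splitting this part off leaves a quadratic form in B y and \<lambda> only, which is
  settled by completing the square.\<close>

definition y_excess where
  "y_excess y = (\<sigma>2 + 1) * block_form bd B y y - (B *v y) \<bullet> (B *v y)"

lemma y_excess_nonneg: "0 \<le> y_excess y"
  using block_form_excess_nonneg[of "\<sigma>2 + 1" B y bd] \<sigma>2 by (simp add: y_excess_def)

lemma y_excess_pos: "y \<noteq> 0 \<Longrightarrow> 0 < y_excess y"
  using block_form_excess_pos[OF _ rank_B, of "\<sigma>2 + 1" y] \<sigma>2 by (simp add: y_excess_def)

lemma norm_completed_square:
  "\<beta> * (norm (b - (1 / \<beta>) *\<^sub>R l))\<^sup>2 = \<beta> * (b \<bullet> b) - 2 * (b \<bullet> l) + (l \<bullet> l) / \<beta>"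
  using \<beta> by (simp add: power2_norm_eq_inner inner_diff_left inner_diff_right inner_commute field_simps)

text \<open>Each parameter restriction controls one summand: \<sigma>1 the first, \<sigma>2 the
  second, s < 1 the third, \<tau> < 1 the last.\<close>

lemma G_quadratic:
  "w \<bullet> (Gm *v w) = x_form (x_part w) (x_part w) + \<beta> * y_excess (y_part w)
    + (1 - s) * \<beta> * (norm (B *v y_part w - (1 / \<beta>) *\<^sub>R l_part w))\<^sup>2
    + (1 - \<tau>) / \<beta> * (norm (l_part w))\<^sup>2"
  unfolding G_form MQ_form y_excess_def mult.assoc[of "1 - s" \<beta>] norm_completed_square
    power2_norm_eq_inner
  unfolding Q_form
  using \<beta> by (simp add: inner_commute algebra_simps diff_divide_distrib add_divide_distrib)

text \<open>The same completed square as for G, now with weight \<tau> + s, and with the remainder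
  on B y in place of \<lambda>.\<close>

lemma H_quadratic:
  "(Mm *v w) \<bullet> (Hm *v (Mm *v w)) = x_form (x_part w) (x_part w) + \<beta> * y_excess (y_part w)
    + (\<tau> + s) * \<beta> * (norm (B *v y_part w - (1 / \<beta>) *\<^sub>R l_part w))\<^sup>2
    + (1 - \<tau>) * \<beta> * (norm (B *v y_part w))\<^sup>2"
  unfolding H_M MQ_form y_excess_def mult.assoc[of "\<tau> + s" \<beta>] norm_completed_square
    power2_norm_eq_inner
  using \<beta> by (simp add: inner_commute algebra_simps diff_divide_distrib add_divide_distrib)

lemma G_pos:
  assumes "w \<noteq> 0"
  shows "0 < w \<bullet> (Gm *v w)"
proof (cases "x_part w = 0 \<and> y_part w = 0")
  case True
  then have "l_part w \<noteq> 0" using assms by (simp add: triple_eq_iff)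
  then have "0 < (1 - \<tau>) / \<beta> * (norm (l_part w))\<^sup>2" using \<tau> \<beta> by simp
  moreover have "0 \<le> (1 - s) * \<beta> * (norm (B *v y_part w - (1 / \<beta>) *\<^sub>R l_part w))\<^sup>2"
    using s \<beta> by (intro mult_nonneg_nonneg) auto
  moreover have "0 \<le> \<beta> * y_excess (y_part w)" using \<beta> y_excess_nonneg by simp
  ultimately show ?thesis
    unfolding G_quadratic using x_form_nonneg[of "x_part w"] by linarith
next
  case False
  then have "0 < x_form (x_part w) (x_part w) + \<beta> * y_excess (y_part w)"
    using x_form_pos[of "x_part w"] x_form_nonneg[of "x_part w"] \<beta>
      y_excess_pos[of "y_part w"] y_excess_nonneg[of "y_part w"]
    by (auto intro: add_pos_nonneg add_nonneg_pos)
  moreover have "0 \<le> (1 - s) * \<beta> * (norm (B *v y_part w - (1 / \<beta>) *\<^sub>R l_part w))\<^sup>2"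
    using s \<beta> by (intro mult_nonneg_nonneg) auto
  moreover have "0 \<le> (1 - \<tau>) / \<beta> * (norm (l_part w))\<^sup>2" using \<tau> \<beta> by simp
  ultimately show ?thesis unfolding G_quadratic by linarith
qed

lemma H_pos:
  assumes "z \<noteq> 0"
  shows "0 < z \<bullet> (Hm *v z)"
proof -
  obtain w where z: "z = Mm *v w" using M_surj by blast
  then have "w \<noteq> 0" using assms by auto
  have l: "0 \<le> (\<tau> + s) * \<beta> * (norm (B *v y_part w - (1 / \<beta>) *\<^sub>R l_part w))\<^sup>2"
    "0 \<le> (1 - \<tau>) * \<beta> * (norm (B *v y_part w))\<^sup>2"
    using \<tau> \<tau>s \<beta> by simp_all
  show ?thesis
  proof (cases "x_part w = 0 \<and> y_part w = 0")
    case True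
    then have "l_part w \<noteq> 0" using \<open>w \<noteq> 0\<close> by (simp add: triple_eq_iff)
    then have "0 < (\<tau> + s) * \<beta> * (norm (B *v y_part w - (1 / \<beta>) *\<^sub>R l_part w))\<^sup>2"
      using True \<tau>s \<beta> by simp
    moreover have "0 \<le> \<beta> * y_excess (y_part w)" using \<beta> y_excess_nonneg by simp
    ultimately show ?thesis
      unfolding z H_quadratic using x_form_nonneg[of "x_part w"] l by linarith
  next
    case False
    then have "0 < x_form (x_part w) (x_part w) + \<beta> * y_excess (y_part w)"
      using x_form_pos[of "x_part w"] x_form_nonneg[of "x_part w"] \<beta>
        y_excess_pos[of "y_part w"] y_excess_nonneg[of "y_part w"]
      by (auto intro: add_pos_nonneg add_nonneg_pos)
    then show ?thesis unfolding z H_quadratic using l by linarith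
  qed
qed

end

subsection \<open>The variational inequality satisfied by the iterates\<close>

text \<open>Minimality is tested along the segment from x to z: convexity bounds F from above, the
  squares are expanded exactly, and dividing by t and letting t tend to 0 leaves the first-order
  term.\<close>

lemma prox_step_vi:
  fixes F :: "'a::real_vector \<Rightarrow> real" and T :: "'a \<Rightarrow> 'b::real_inner"
  assumes F: "convex_on S F" and T: "linear T" and xz: "x \<in> S" "z \<in> S"
    and min: "\<And>u. u \<in> S \<Longrightarrow>
      F x - l \<bullet> T x + \<beta> / 2 * (norm (T x + a))\<^sup>2 + \<gamma> / 2 * (norm (T x - b))\<^sup>2
      \<le> F u - l \<bullet> T u + \<beta> / 2 * (norm (T u + a))\<^sup>2 + \<gamma> / 2 * (norm (T u - b))\<^sup>2"
  shows "0 \<le> F z - F x + (\<beta> *\<^sub>R (T x + a) + \<gamma> *\<^sub>R (T x - b) - l) \<bullet> T (z - x)"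
proof -
  define D where "D = T (z - x)"
  define p where "p = F z - F x + (\<beta> *\<^sub>R (T x + a) + \<gamma> *\<^sub>R (T x - b) - l) \<bullet> D"
  define K where "K = (\<beta> + \<gamma>) / 2 * (D \<bullet> D)"
  have "0 \<le> p + t * K" if t: "0 < t" "t \<le> 1" for t
  proof -
    let ?u = "(1 - t) *\<^sub>R x + t *\<^sub>R z"
    have "?u \<in> S"
      using convex_on_imp_convex[OF F] xz t by (intro convexD_alt) auto
    note min[OF this]
    moreover have "T ?u = T x + t *\<^sub>R D"
      by (simp add: D_def linear_add[OF T] linear_diff[OF T] linear_scale[OF T] algebra_simps)
    moreover have "F ?u \<le> F x + t * (F z - F x)"
      using convex_onD[OF F, of t x z] t xz by (simp add: algebra_simps)
    ultimately have "0 \<le> t * (F z - F x) - l \<bullet> (t *\<^sub>R D)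
        + \<beta> / 2 * ((norm (T x + a + t *\<^sub>R D))\<^sup>2 - (norm (T x + a))\<^sup>2)
        + \<gamma> / 2 * ((norm (T x - b + t *\<^sub>R D))\<^sup>2 - (norm (T x - b))\<^sup>2)"
      by (simp add: inner_add_right algebra_simps)
    also have "\<dots> = t * (p + t * K)"
    proof -
      have expand: "(norm (v + t *\<^sub>R D))\<^sup>2 - (norm v)\<^sup>2 = 2 * t * (v \<bullet> D) + t * t * (D \<bullet> D)" for v
        unfolding power2_norm_eq_inner inner_add_left inner_add_right inner_scaleR_left inner_scaleR_right
        by (simp add: inner_commute algebra_simps)
      show ?thesis
        unfolding expand p_def K_def inner_add_left inner_diff_left[of _ l] inner_scaleR_left
          inner_scaleR_right
        by (simp add: field_simps)
    qed
    finally show ?thesis using t(1) by (simp add: zero_le_mult_iff)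
  qed
  then have "eventually (\<lambda>t. 0 \<le> p + t * K) (at_right 0)"
    by (auto simp: eventually_at_right_field intro!: exI[of _ 1])
  moreover have "((\<lambda>t. p + t * K) \<longlongrightarrow> p + 0 * K) (at_right 0)"
    by (intro tendsto_intros)
  ultimately have "0 \<le> p + 0 * K"
    by (intro tendsto_lowerbound) auto
  then show ?thesis by (simp add: p_def D_def)
qed

lemma sum_block_update:
  fixes b :: "'m::finite \<Rightarrow> 'p::finite"
  assumes "z \<in> block_space b i"
  shows "(\<Sum>l\<in>UNIV. f l (block b l (block_update b i x z))) = f i z + (\<Sum>l\<in>UNIV - {i}. f l (block b l x))"
  by (subst sum.remove[of _ i]) (auto simp: block_block_update block_eq_self[OF assms])

lemma mult_block_update:
  assumes "z \<in> block_space b i"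
  shows "A *v block_update b i x z = A *v z + (A *v x - A *v block b i x)"
  by (simp add: block_update_eq block_eq_self[OF assms] matrix_vector_right_distrib
      matrix_vector_mult_diff_distrib)

lemma is_arg_min_add_const: "is_arg_min (\<lambda>v. F v + K) P x \<longleftrightarrow> is_arg_min F P x" for K :: real
  by (simp add: is_arg_min_def)

text \<open>The gradient is taken at the old x because all other blocks are frozen there. The
  block's own move enters the penalty with weight \<beta> and the proximal term with weight \<sigma>
  \<beta>, which explains the factor (1 + \<sigma>) \<beta>.\<close>

lemma block_prox_step_vi:
  fixes b :: "'m::finite \<Rightarrow> 'p::finite" and A :: "real ^ 'm ^ 'n::finite"
  assumes S: "S \<subseteq> block_space b i" "convex S" and f: "convex_on (block_space b i) (f i)"
    and min: "is_arg_min (\<lambda>z. (\<Sum>l\<in>UNIV. f l (block b l (block_update b i x z)))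
        - \<mu> \<bullet> (A *v block_update b i x z + r) + \<beta> / 2 * (norm (A *v block_update b i x z + r))\<^sup>2
        + \<sigma> * \<beta> / 2 * (norm (col_block b i A *v (z - block b i x)))\<^sup>2)
      (\<lambda>z. z \<in> S) (block b i x')"
    and z: "z \<in> S"
  shows "0 \<le> f i z - f i (block b i x')
    + (\<beta> *\<^sub>R (A *v x + r) - \<mu> + ((1 + \<sigma>) * \<beta>) *\<^sub>R (A *v block b i (x' - x))) \<bullet> (A *v (z - block b i x'))"
proof -
  let ?a = "A *v x - A *v block b i x + r"
  have S': "block b i x' \<in> S" using min by (simp add: is_arg_min_def)
  have "0 \<le> f i z - f i (block b i x') + (\<beta> *\<^sub>R (A *v block b i x' + ?a)
      + (\<sigma> * \<beta>) *\<^sub>R (A *v block b i x' - A *v block b i x) - \<mu>) \<bullet> (A *v (z - block b i x'))"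
  proof (rule prox_step_vi[OF _ matrix_vector_mul_linear S' z])
    show "convex_on S (f i)" using f S by (rule convex_on_subset)
    fix u assume u: "u \<in> S"
    have obj: "(\<Sum>l\<in>UNIV. f l (block b l (block_update b i x v)))
        - \<mu> \<bullet> (A *v block_update b i x v + r) + \<beta> / 2 * (norm (A *v block_update b i x v + r))\<^sup>2
        + \<sigma> * \<beta> / 2 * (norm (col_block b i A *v (v - block b i x)))\<^sup>2
        = f i v - \<mu> \<bullet> (A *v v) + \<beta> / 2 * (norm (A *v v + ?a))\<^sup>2
          + \<sigma> * \<beta> / 2 * (norm (A *v v - A *v block b i x))\<^sup>2
          + ((\<Sum>l\<in>UNIV - {i}. f l (block b l x)) - \<mu> \<bullet> ?a)" if "v \<in> S" for v
    proof -
      have v: "v \<in> block_space b i" using that S(1) by blast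
      have prox: "col_block b i A *v (v - block b i x) = A *v v - A *v block b i x"
        using v by (simp add: col_block_mult linear_diff[OF linear_block] block_eq_self block_block
            matrix_vector_mult_diff_distrib)
      have "A *v block_update b i x v + r = A *v v + ?a"
        using mult_block_update[OF v, of A x] by (simp add: algebra_simps)
      then show ?thesis
        unfolding sum_block_update[OF v] prox by (simp only: inner_add_right)
    qed
    show "f i (block b i x') - \<mu> \<bullet> (A *v block b i x') + \<beta> / 2 * (norm (A *v block b i x' + ?a))\<^sup>2
        + \<sigma> * \<beta> / 2 * (norm (A *v block b i x' - A *v block b i x))\<^sup>2
      \<le> f i u - \<mu> \<bullet> (A *v u) + \<beta> / 2 * (norm (A *v u + ?a))\<^sup>2
        + \<sigma> * \<beta> / 2 * (norm (A *v u - A *v block b i x))\<^sup>2"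
      using min[unfolded is_arg_min_linorder, THEN conjunct2, rule_format, OF u]
      unfolding obj[OF S'] obj[OF u] by simp
  qed
  moreover have "\<beta> *\<^sub>R (A *v block b i x' + ?a) + (\<sigma> * \<beta>) *\<^sub>R (A *v block b i x' - A *v block b i x) - \<mu>
      = \<beta> *\<^sub>R (A *v x + r) - \<mu> + ((1 + \<sigma>) * \<beta>) *\<^sub>R (A *v block b i (x' - x))"
    by (simp add: linear_diff[OF linear_block] matrix_vector_mult_diff_distrib algebra_simps)
  ultimately show ?thesis by simp
qed

lemma sum_block_vi:
  fixes b :: "'m::finite \<Rightarrow> 'p::finite" and A :: "real ^ 'm ^ 'n::finite"
  assumes "\<And>i. 0 \<le> f i (block b i z) - f i (block b i x')
    + (q + r *\<^sub>R (A *v block b i d)) \<bullet> (A *v (block b i z - block b i x'))"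
  shows "0 \<le> (\<Sum>i\<in>UNIV. f i (block b i z)) - (\<Sum>i\<in>UNIV. f i (block b i x'))
    + q \<bullet> (A *v (z - x')) + r * block_form b A (z - x') d"
proof -
  have "0 \<le> (\<Sum>i\<in>UNIV. f i (block b i z) - f i (block b i x')
      + (q + r *\<^sub>R (A *v block b i d)) \<bullet> (A *v (block b i z - block b i x')))"
    using assms by (rule sum_nonneg)
  also have "\<dots> = (\<Sum>i\<in>UNIV. f i (block b i z)) - (\<Sum>i\<in>UNIV. f i (block b i x'))
      + q \<bullet> (\<Sum>i\<in>UNIV. A *v block b i (z - x')) + r * block_form b A (z - x') d"
    by (simp add: sum.distrib sum_subtractf inner_add_left inner_sum_right sum_distrib_left
        block_form_def inner_commute linear_diff[OF linear_block])
  also have "(\<Sum>i\<in>UNIV. A *v block b i (z - x')) = A *v (z - x')" by (rule sum_mult_block)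
  finally show ?thesis .
qed

locale gs_admm_run = gs_admm_matrices bx bd A B \<beta> \<sigma>1 \<sigma>2 \<tau> s
  for bx :: "'m::finite \<Rightarrow> 'p::finite" and bd :: "'d::finite \<Rightarrow> 'q::finite"
    and A :: "real ^ 'm ^ 'n::finite" and B :: "real ^ 'd ^ 'n"
    and \<beta> \<sigma>1 \<sigma>2 \<tau> s :: real +
  fixes f :: "'p \<Rightarrow> real ^ 'm \<Rightarrow> real" and g :: "'q \<Rightarrow> real ^ 'd \<Rightarrow> real" and c :: "real ^ 'n"
    and X :: "'p \<Rightarrow> (real ^ 'm) set" and Y :: "'q \<Rightarrow> (real ^ 'd) set"
    and w :: "nat \<Rightarrow> real ^ ('m + 'd + 'n)"
  assumes f: "\<And>i. convex_on (block_space bx i) (f i)"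
    and g: "\<And>j. convex_on (block_space bd j) (g j)"
    and X: "\<And>i. X i \<subseteq> block_space bx i" "\<And>i. polyhedron (X i)"
    and Y: "\<And>j. Y j \<subseteq> block_space bd j" "\<And>j. polyhedron (Y j)"
    and solvable: "\<exists>x y. is_solution bx bd f g A B c X Y x y"
    and f_pl: "\<And>i. piecewise_linear_mf (subdiff_on (block_space bx i) (f i))"
    and g_pl: "\<And>j. piecewise_linear_mf (subdiff_on (block_space bd j) (g j))"
    and admm: "gs_admm bx bd f g A B c X Y \<beta> \<sigma>1 \<sigma>2 \<tau> s w"
begin

definition h where "h u = objective bx bd f g (fst u) (snd u)"
definition C where "C = block_product bx X \<times> block_product bd Y"
definition E where "E u = A *v fst u + B *v snd u"
definition solutions :: "(real ^ ('m + 'd + 'n)) set" where "solutions = M_star bx bd f g A B c X Y"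
definition upart where "upart v = (x_part v, y_part v)"
definition residual where "residual x y = A *v x + B *v y - c"

text \<open>Whatever \<tau> and s are, the multiplier makes a full step \<beta> along the residual
  of the new x and the old y; the actual stepsizes enter through Q and M.\<close>

definition predictor where
  "predictor k = stack (x_part (w (Suc k))) (y_part (w (Suc k)))
     (l_part (w k) - \<beta> *\<^sub>R residual (x_part (w (Suc k))) (y_part (w k)))"

definition step where "step k = predictor k - w k"

lemma linear_E: "linear E"
  by (auto simp: E_def linear_iff matrix_vector_right_distrib matrix_vector_mult_scaleR algebra_simps)

lemma convex_h: "convex_on UNIV h"
  using convex_on_objective[where f = f and g = g, OF f g] by (simp add: h_def[abs_def])

lemma polyhedron_C: "polyhedron C"
proof -
  have "C = fst -` block_product bx X \<inter> snd -` block_product bd Y" by (auto simp: C_def)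
  then show ?thesis
    using X Y by (auto intro!: polyhedron_Int polyhedron_linear_vimage[OF _ linear_fst]
        polyhedron_linear_vimage[OF _ linear_snd] polyhedron_block_product)
qed

lemma step_parts:
  "x_part (step k) = x_part (w (Suc k)) - x_part (w k)"
  "y_part (step k) = y_part (w (Suc k)) - y_part (w k)"
  "l_part (step k) = - (\<beta> *\<^sub>R residual (x_part (w (Suc k))) (y_part (w k)))"
  by (simp_all add: step_def predictor_def)

text \<open>The two residuals in the dual updates differ by B applied to the change of y, so both
  updates are linear in the y and \<lambda> components of the step: this is the last row of
  M.\<close>

lemma corrector: "w (Suc k) = w k + Mm *v step k"
proof -
  have "l_part (w (Suc k)) = l_part (w k) - (\<tau> * \<beta>) *\<^sub>R residual (x_part (w (Suc k))) (y_part (w k))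
      - (s * \<beta>) *\<^sub>R residual (x_part (w (Suc k))) (y_part (w (Suc k)))"
    using admm by (simp add: gs_admm_def lambda_half_def residual_def)
  also have "residual (x_part (w (Suc k))) (y_part (w (Suc k)))
      = residual (x_part (w (Suc k))) (y_part (w k)) + B *v y_part (step k)"
    by (simp add: residual_def step_parts matrix_vector_mult_diff_distrib)
  finally show ?thesis
    by (simp add: triple_eq_iff M_parts step_parts(1,2)) (simp add: step_parts(3) algebra_simps)
qed

lemma iterate_blocks: "block bx i (x_part (w (Suc k))) \<in> X i" "block bd j (y_part (w (Suc k))) \<in> Y j"
  using admm by (auto simp: gs_admm_def is_arg_min_def)

lemma predictor_in_C: "upart (predictor k) \<in> C"
  using iterate_blocks by (simp add: upart_def predictor_def C_def block_product_def)

lemma x_step_vi: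
  assumes "z \<in> block_product bx X"
  shows "0 \<le> (\<Sum>i\<in>UNIV. f i (block bx i z)) - (\<Sum>i\<in>UNIV. f i (block bx i (x_part (w (Suc k)))))
    - l_part (predictor k) \<bullet> (A *v (z - x_part (w (Suc k)))) + x_form (z - x_part (w (Suc k))) (x_part (step k))"
proof -
  let ?x = "x_part (w k)" and ?x' = "x_part (w (Suc k))" and ?y = "y_part (w k)" and ?l = "l_part (w k)"
  let ?q = "\<beta> *\<^sub>R (A *v ?x + (B *v ?y - c)) - ?l"
  have "0 \<le> f i (block bx i z) - f i (block bx i ?x')
      + (?q + ((1 + \<sigma>1) * \<beta>) *\<^sub>R (A *v block bx i (?x' - ?x))) \<bullet> (A *v (block bx i z - block bx i ?x'))" for i
  proof (rule block_prox_step_vi[OF X(1) polyhedron_imp_convex[OF X(2)] f])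
    show "block bx i z \<in> X i" using assms by (simp add: block_product_def)
    let ?G = "\<Sum>j\<in>UNIV. g j (block bd j ?y)"
    have aug: "aug_lagrangian bx bd f g A B c \<beta> v ?y ?l + r = (\<Sum>l\<in>UNIV. f l (block bx l v))
        - ?l \<bullet> (A *v v + (B *v ?y - c)) + \<beta> / 2 * (norm (A *v v + (B *v ?y - c)))\<^sup>2 + r + ?G" for v r
      by (simp add: aug_lagrangian_def objective_def add_diff_eq)
    have "is_arg_min
        (\<lambda>v. aug_lagrangian bx bd f g A B c \<beta> (block_update bx i ?x v) ?y ?l
             + \<sigma>1 * \<beta> / 2 * (norm (col_block bx i A *v (v - block bx i ?x)))\<^sup>2)
        (\<lambda>v. v \<in> X i) (block bx i ?x')"
      using admm unfolding gs_admm_def by blast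
    then show "is_arg_min (\<lambda>v. (\<Sum>l\<in>UNIV. f l (block bx l (block_update bx i ?x v)))
        - ?l \<bullet> (A *v block_update bx i ?x v + (B *v ?y - c))
        + \<beta> / 2 * (norm (A *v block_update bx i ?x v + (B *v ?y - c)))\<^sup>2
        + \<sigma>1 * \<beta> / 2 * (norm (col_block bx i A *v (v - block bx i ?x)))\<^sup>2)
      (\<lambda>z. z \<in> X i) (block bx i ?x')"
      unfolding aug is_arg_min_add_const .
  qed
  then have "0 \<le> (\<Sum>i\<in>UNIV. f i (block bx i z)) - (\<Sum>i\<in>UNIV. f i (block bx i ?x'))
      + ?q \<bullet> (A *v (z - ?x')) + (1 + \<sigma>1) * \<beta> * block_form bx A (z - ?x') (?x' - ?x)"
    by (rule sum_block_vi)
  \<comment> \<open>Replacing the old x by the new one in the residual leaves a term that turns (1 +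
    \<sigma>1) \<beta> \<open>block_form\<close> into the form of \<open>Hx_mat\<close>.\<close>
  moreover have "?q = - l_part (predictor k) - \<beta> *\<^sub>R (A *v x_part (step k))"
    by (simp add: predictor_def residual_def step_parts matrix_vector_mult_diff_distrib algebra_simps)
  ultimately show ?thesis
    using inner_commute[of "A *v x_part (step k)" "A *v (z - ?x')"]
    by (simp add: x_form_def inner_diff_left flip: step_parts(1))
qed

lemma y_step_vi:
  assumes "z \<in> block_product bd Y"
  shows "0 \<le> (\<Sum>j\<in>UNIV. g j (block bd j z)) - (\<Sum>j\<in>UNIV. g j (block bd j (y_part (w (Suc k)))))
    - l_part (predictor k) \<bullet> (B *v (z - y_part (w (Suc k)))) - \<tau> * (l_part (step k) \<bullet> (B *v (z - y_part (w (Suc k)))))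
    + (\<sigma>2 + 1) * \<beta> * block_form bd B (z - y_part (w (Suc k))) (y_part (step k))"
proof -
  let ?x' = "x_part (w (Suc k))" and ?y = "y_part (w k)" and ?y' = "y_part (w (Suc k))"
  let ?l = "lambda_half A B c \<beta> \<tau> w k"
  let ?q = "\<beta> *\<^sub>R (B *v ?y + (A *v ?x' - c)) - ?l"
  have "0 \<le> g j (block bd j z) - g j (block bd j ?y')
      + (?q + ((1 + \<sigma>2) * \<beta>) *\<^sub>R (B *v block bd j (?y' - ?y))) \<bullet> (B *v (block bd j z - block bd j ?y'))" for j
  proof (rule block_prox_step_vi[OF Y(1) polyhedron_imp_convex[OF Y(2)] g])
    show "block bd j z \<in> Y j" using assms by (simp add: block_product_def)
    let ?F = "\<Sum>i\<in>UNIV. f i (block bx i ?x')"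
    have "A *v ?x' + B *v v - c = B *v v + (A *v ?x' - c)" for v by simp
    then have aug: "aug_lagrangian bx bd f g A B c \<beta> ?x' v ?l + r = (\<Sum>l\<in>UNIV. g l (block bd l v))
        - ?l \<bullet> (B *v v + (A *v ?x' - c)) + \<beta> / 2 * (norm (B *v v + (A *v ?x' - c)))\<^sup>2 + r + ?F" for v r
      by (simp only: aug_lagrangian_def objective_def)
    have "is_arg_min
        (\<lambda>v. aug_lagrangian bx bd f g A B c \<beta> ?x' (block_update bd j ?y v) ?l
             + \<sigma>2 * \<beta> / 2 * (norm (col_block bd j B *v (v - block bd j ?y)))\<^sup>2)
        (\<lambda>v. v \<in> Y j) (block bd j ?y')"
      using admm unfolding gs_admm_def by blast
    then show "is_arg_min (\<lambda>v. (\<Sum>l\<in>UNIV. g l (block bd l (block_update bd j ?y v)))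
        - ?l \<bullet> (B *v block_update bd j ?y v + (A *v ?x' - c))
        + \<beta> / 2 * (norm (B *v block_update bd j ?y v + (A *v ?x' - c)))\<^sup>2
        + \<sigma>2 * \<beta> / 2 * (norm (col_block bd j B *v (v - block bd j ?y)))\<^sup>2)
      (\<lambda>z. z \<in> Y j) (block bd j ?y')"
      unfolding aug is_arg_min_add_const .
  qed
  then have "0 \<le> (\<Sum>j\<in>UNIV. g j (block bd j z)) - (\<Sum>j\<in>UNIV. g j (block bd j ?y'))
      + ?q \<bullet> (B *v (z - ?y')) + (1 + \<sigma>2) * \<beta> * block_form bd B (z - ?y') (?y' - ?y)"
    by (rule sum_block_vi)
  \<comment> \<open>With r the residual of the new x and old y, the gradient coefficient is (1 +
    \<tau>) \<beta> r minus the old multiplier. The predicted multiplier absorbs one \<beta> r; the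
    rest is the block of Q that carries \<tau>.\<close>
  moreover have "?q = - l_part (predictor k) - \<tau> *\<^sub>R l_part (step k)"
    by (simp add: lambda_half_def predictor_def residual_def step_parts algebra_simps)
  ultimately show ?thesis
    by (simp add: inner_diff_left add.commute[of 1] flip: step_parts(2))
qed

lemma predictor_vi:
  assumes "u \<in> C"
  shows "0 \<le> h u - h (upart (predictor k)) - l_part (predictor k) \<bullet> E (u - upart (predictor k))
    + upart (Qm *v step k) \<bullet> (u - upart (predictor k))"
proof -
  obtain zx zy where u: "u = (zx, zy)" by fastforce
  have z: "zx \<in> block_product bx X" "zy \<in> block_product bd Y" using assms by (auto simp: C_def u)
  have "upart (Qm *v step k) \<bullet> (u - upart (predictor k))
      = x_form (zx - x_part (w (Suc k))) (x_part (step k))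
        + (\<sigma>2 + 1) * \<beta> * block_form bd B (zy - y_part (w (Suc k))) (y_part (step k))
        - \<tau> * (l_part (step k) \<bullet> (B *v (zy - y_part (w (Suc k)))))"
    unfolding inner_commute[of "upart (Qm *v step k)"]
    by (simp add: upart_def u predictor_def Q_parts inner_Hx_mat inner_DB_mat x_form_def
        inner_diff_right[of "zy - y_part (w (Suc k))"] inner_vector_matrix_mult inner_commute[of "l_part (step k)"])
  then show ?thesis
    using x_step_vi[OF z(1), of k] y_step_vi[OF z(2), of k]
    by (simp add: u upart_def predictor_def h_def objective_def E_def inner_add_right)
qed

text \<open>The last row of Q applied to the step is minus the primal residual of the new
  iterate.\<close>

lemma predictor_constraint: "E (upart (predictor k)) - (- l_part (Qm *v step k)) = c"
  using \<beta> by (simp add: upart_def predictor_def E_def Q_parts step_parts residual_def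
      matrix_vector_mult_diff_distrib)

subsection \<open>Primal-dual solutions and Fejer monotonicity\<close>

lemma inner_J_map: "(v - v') \<bullet> J_map A B c v
    = - l_part v \<bullet> E (upart v - upart v') + (l_part v - l_part v') \<bullet> (E (upart v) - c)"
  by (simp add: inner_triple J_map_def E_def upart_def inner_vector_matrix_mult
      inner_add_right inner_diff_right inner_commute algebra_simps)

lemma M_set_iff: "v \<in> M_set bx bd X Y \<longleftrightarrow> upart v \<in> C"
  by (simp add: M_set_def C_def upart_def)

lemma h_upart: "h (upart v) = objective bx bd f g (x_part v) (y_part v)"
  by (simp add: h_def upart_def)

text \<open>\<open>M_star\<close> evaluates J at the test point rather than at the solution. The
  linear part of J is skew, so the two values pair equally with the difference, and the optimality
  conditions suffice.\<close>

lemma solutionsI: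
  assumes "u \<in> C" "E u = c" "\<And>z. z \<in> C \<Longrightarrow> 0 \<le> h z - h u - l \<bullet> E (z - u)"
  shows "stack (fst u) (snd u) l \<in> solutions"
proof -
  let ?v = "stack (fst u) (snd u) l"
  have v: "upart ?v = u" "l_part ?v = l" by (simp_all add: upart_def)
  have "0 \<le> h (upart z) - h (upart ?v) + (z - ?v) \<bullet> J_map A B c z" if "z \<in> M_set bx bd X Y" for z
    using assms(3)[of "upart z"] that assms(2)
    unfolding inner_J_map v M_set_iff
    by (simp add: linear_diff[OF linear_E] inner_diff_left)
  then show ?thesis
    using assms(1) v(1) by (simp add: solutions_def M_star_def M_set_iff flip: h_upart)
qed

lemma solutions_nonempty: "solutions \<noteq> {}"
proof -
  obtain x y where sol: "is_solution bx bd f g A B c X Y x y" using solvable by blast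
  then have xy: "(x, y) \<in> C" "E (x, y) = c" by (auto simp: is_solution_def is_arg_min_def C_def E_def)
  have "h (x, y) \<le> h z" if "z \<in> C" "E z = E (x, y)" for z
    using sol that xy(2) by (cases z) (auto simp: is_solution_def is_arg_min_def C_def E_def h_def not_less)
  then obtain l where "\<And>z. z \<in> C \<Longrightarrow> 0 \<le> h z - h (x, y) - l \<bullet> E (z - (x, y))"
    using lagrange_multiplier_exists[OF convex_h polyhedron_C linear_E xy(1)] by blast
  from solutionsI[OF xy this] show ?thesis by blast
qed

text \<open>The inequality defining \<open>M_star\<close> may be tested at the predictor, and the
  predictor's inequality at v; adding them cancels the objective and multiplier terms and leaves
  only the residual \<open>Qm *v step k\<close>.\<close>

lemma contraction:
  assumes "v \<in> solutions"
  shows "sq_norm Hm (w (Suc k) - v) \<le> sq_norm Hm (w k - v) - step k \<bullet> (Gm *v step k)"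
proof -
  let ?p = "predictor k" and ?d = "step k"
  have v: "upart v \<in> C"
    and opt: "\<And>z. upart z \<in> C \<Longrightarrow> 0 \<le> h (upart z) - h (upart v) + (z - v) \<bullet> J_map A B c z"
    using assms predictor_in_C[of k] by (auto simp: solutions_def M_star_def M_set_iff h_upart)
  have "0 \<le> h (upart ?p) - h (upart v) - l_part ?p \<bullet> E (upart ?p - upart v)
      + (l_part ?p - l_part v) \<bullet> (E (upart ?p) - c)"
    using opt[OF predictor_in_C[of k]] unfolding inner_J_map by simp
  moreover have "E (upart ?p) - c = - l_part (Qm *v ?d)"
    using predictor_constraint[of k] by (simp add: algebra_simps)
  moreover note predictor_vi[OF v, of k]
  moreover have "E (upart v - upart ?p) = - E (upart ?p - upart v)"
    by (simp add: linear_diff[OF linear_E])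
  ultimately have "0 \<le> upart (Qm *v ?d) \<bullet> (upart v - upart ?p) + l_part (Qm *v ?d) \<bullet> (l_part v - l_part ?p)"
    by (simp add: inner_diff_left inner_diff_right inner_commute)
  also have "\<dots> = (v - ?p) \<bullet> (Qm *v ?d)"
    by (simp add: inner_triple upart_def inner_commute)
  also have "v - ?p = (v - w k) - ?d" by (simp add: step_def)
  finally have le: "(w k - v) \<bullet> (Qm *v ?d) \<le> - (?d \<bullet> (Qm *v ?d))"
    by (simp add: inner_diff_left)
  let ?e = "w k - v"
  have "sq_norm Hm (w (Suc k) - v) = (?e + Mm *v ?d) \<bullet> (Hm *v (?e + Mm *v ?d))"
    by (simp add: corrector sq_norm_def algebra_simps)
  also have "\<dots> = ?e \<bullet> (Hm *v ?e) + 2 * (?e \<bullet> (Qm *v ?d)) + (Mm *v ?d) \<bullet> (Qm *v ?d)"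
    using H_symmetric[of ?e "Mm *v ?d"]
    by (simp only: matrix_vector_right_distrib inner_add_left inner_add_right H_M)
  \<comment> \<open>The definition of G is made for this: d G d = 2 d Q d - (M d) (Q d).\<close>
  also have "\<dots> \<le> ?e \<bullet> (Hm *v ?e) - ?d \<bullet> (Gm *v ?d)"
    using le by (simp add: G_form)
  finally show ?thesis by (simp add: sq_norm_def)
qed

lemma sq_norm_H_nonneg: "0 \<le> sq_norm Hm v"
  using H_pos[of v] by (cases "v = 0") (auto simp: sq_norm_def intro: less_imp_le)

lemma G_nonneg: "0 \<le> v \<bullet> (Gm *v v)"
  using G_pos[of v] by (cases "v = 0") (auto intro: less_imp_le)

lemma sq_norm_H_le_initial:
  assumes "v \<in> solutions"
  shows "sq_norm Hm (w k - v) \<le> sq_norm Hm (w 0 - v)"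
proof (induction k)
  case (Suc k)
  then show ?case using contraction[OF assms, of k] G_nonneg[of "step k"] by linarith
qed simp

lemma iterates_bounded:
  assumes "v \<in> solutions"
  obtains R where "0 < R" "\<And>k. norm (w k - v) \<le> R"
proof -
  obtain \<gamma> where \<gamma>: "0 < \<gamma>" "\<And>z. \<gamma> * (norm z)\<^sup>2 \<le> z \<bullet> (Hm *v z)"
    using positive_definite_lower_bound[of Hm] H_pos by blast
  define R where "R = sqrt (sq_norm Hm (w 0 - v) / \<gamma>) + 1"
  have "norm (w k - v) \<le> R" for k
  proof -
    have "\<gamma> * (norm (w k - v))\<^sup>2 \<le> sq_norm Hm (w 0 - v)"
      using \<gamma>(2)[of "w k - v"] sq_norm_H_le_initial[OF assms, of k] by (simp add: sq_norm_def)
    then have "norm (w k - v) \<le> sqrt (sq_norm Hm (w 0 - v) / \<gamma>)"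
      using \<gamma>(1) by (intro real_le_rsqrt) (simp add: pos_le_divide_eq mult.commute)
    then show ?thesis by (simp add: R_def)
  qed
  moreover have "0 < R"
    using sq_norm_H_nonneg \<gamma>(1) by (simp add: R_def add_nonneg_pos)
  ultimately show ?thesis using that by blast
qed

subsection \<open>Error bound along the iterates and the linear rate\<close>

lemma norm_upart_l_part: "norm (upart v, l_part v) = norm v"
  by (simp add: norm_triple upart_def)

lemma error_bound:
  obtains Z where "0 < Z" "\<And>k. \<exists>v\<in>solutions. norm (w (Suc k) - v) \<le> Z * norm (step k)"
proof -
  have pu: "polyhedral_union {(u, v). v \<in> subgradients h u}"
    using polyhedral_union_subgradients_objective[where f = f and g = g, OF f_pl g_pl]
    by (simp add: h_def[abs_def])
  obtain \<kappa> where \<kappa>: "0 < \<kappa>"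
    "\<And>u l \<rho> \<sigma>. u \<in> C \<Longrightarrow> (\<And>z. z \<in> C \<Longrightarrow> 0 \<le> h z - h u - l \<bullet> E (z - u) + \<rho> \<bullet> (z - u))
      \<Longrightarrow> E u - \<sigma> = c \<Longrightarrow> norm (\<rho>, \<sigma>) < 1 / \<kappa> \<Longrightarrow>
      \<exists>u' l'. u' \<in> C \<and> E u' = c \<and> (\<forall>z\<in>C. 0 \<le> h z - h u' - l' \<bullet> E (z - u'))
        \<and> norm ((u, l) - (u', l')) \<le> \<kappa> * norm (\<rho>, \<sigma>)"
    by (rule perturbed_vi_error_bound[OF convex_h polyhedron_C linear_E pu, of c]) (rule that, assumption, blast)
  obtain KQ where KQ: "0 < KQ" "\<And>v. norm (Qm *v v) \<le> norm v * KQ"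
    using bounded_linear.pos_bounded[OF matrix_vector_mul_bounded_linear[of Qm]] by blast
  obtain KM where KM: "0 < KM" "\<And>v. norm (Mm *v v) \<le> norm v * KM"
    using bounded_linear.pos_bounded[OF matrix_vector_mul_bounded_linear[of Mm]] by blast
  obtain v0 where v0: "v0 \<in> solutions" using solutions_nonempty by blast
  obtain R where R: "0 < R" "\<And>k. norm (w k - v0) \<le> R" using iterates_bounded[OF v0] by blast
  \<comment> \<open>The first three summands pay for the correction, the prediction and the local
    error bound; the last one pays for large residuals.\<close>
  define Z where "Z = KM + 1 + \<kappa> * KQ + R * \<kappa> * KQ"
  have "\<exists>v\<in>solutions. norm (w (Suc k) - v) \<le> Z * norm (step k)" for k
  proof (cases "norm (Qm *v step k) < 1 / \<kappa>")
    case True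
    let ?p = "predictor k"
    have nQ: "norm (upart (Qm *v step k), - l_part (Qm *v step k)) = norm (Qm *v step k)"
      by (simp add: norm_Pair flip: norm_upart_l_part[of "Qm *v step k"])
    have "\<exists>u' l'. u' \<in> C \<and> E u' = c \<and> (\<forall>z\<in>C. 0 \<le> h z - h u' - l' \<bullet> E (z - u'))
        \<and> norm ((upart ?p, l_part ?p) - (u', l')) \<le> \<kappa> * norm (upart (Qm *v step k), - l_part (Qm *v step k))"
    proof (rule \<kappa>(2)[OF predictor_in_C _ predictor_constraint])
      show "norm (upart (Qm *v step k), - l_part (Qm *v step k)) < 1 / \<kappa>" using True by (simp only: nQ)
    qed (rule predictor_vi)
    then obtain u' l' where ul: "u' \<in> C" "E u' = c" "\<forall>z\<in>C. 0 \<le> h z - h u' - l' \<bullet> E (z - u')"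
      and near: "norm ((upart ?p, l_part ?p) - (u', l')) \<le> \<kappa> * norm (Qm *v step k)"
      unfolding nQ by blast
    let ?v = "stack (fst u') (snd u') l'"
    have v: "?v \<in> solutions" by (rule solutionsI[OF ul(1,2)]) (rule ul(3)[rule_format])
    \<comment> \<open>The error bound concerns the predictor; its distance to the next iterate is
      again controlled by the step.\<close>
    have split: "w (Suc k) - ?v = Mm *v step k - step k + (?p - ?v)"
      using corrector[of k] by (simp add: step_def)
    have "norm (w (Suc k) - ?v) \<le> norm (Mm *v step k) + norm (step k) + norm (?p - ?v)"
      unfolding split using norm_triangle_ineq[of "Mm *v step k - step k" "?p - ?v"]
        norm_triangle_ineq4[of "Mm *v step k" "step k"] by linarith
    moreover have "norm (?p - ?v) \<le> \<kappa> * norm (Qm *v step k)"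
      using near norm_upart_l_part[of "?p - ?v"] by (simp add: upart_def prod_eq_iff minus_prod_def)
    moreover have "\<kappa> * norm (Qm *v step k) \<le> \<kappa> * (norm (step k) * KQ)"
      using \<kappa>(1) by (intro mult_left_mono KQ) auto
    ultimately have "norm (w (Suc k) - ?v) \<le> (KM + 1 + \<kappa> * KQ) * norm (step k)"
      using KM(2)[of "step k"] by (simp add: algebra_simps)
    also have "\<dots> \<le> Z * norm (step k)"
      using R(1) \<kappa>(1) KQ(1) by (intro mult_right_mono) (auto simp: Z_def)
    finally show ?thesis using v by blast
  next
    case False
    \<comment> \<open>A large residual keeps the step away from zero, so the fixed bound R is itself
      a multiple of the step length.\<close>
    have "1 / \<kappa> \<le> norm (step k) * KQ" using False KQ(2)[of "step k"] by linarith
    then have "1 \<le> \<kappa> * KQ * norm (step k)"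
      using \<kappa>(1) by (simp add: divide_le_eq mult_ac)
    then have "R * 1 \<le> R * (\<kappa> * KQ * norm (step k))"
      using R(1) by (intro mult_left_mono) auto
    then have "norm (w (Suc k) - v0) \<le> (R * \<kappa> * KQ) * norm (step k)"
      using R(2)[of "Suc k"] by (simp add: mult_ac)
    also have "\<dots> \<le> Z * norm (step k)"
      using KM(1) \<kappa>(1) KQ(1) by (intro mult_right_mono) (auto simp: Z_def)
    finally show ?thesis using v0 by blast
  qed
  moreover have "0 < Z"
    using KM(1) \<kappa>(1) KQ(1) R(1) by (simp add: Z_def add_pos_pos)
  ultimately show ?thesis using that by blast
qed

lemma dist_sq_H_le: "v \<in> solutions \<Longrightarrow> dist_sq Hm z solutions \<le> sq_norm Hm (z - v)"
  unfolding dist_sq_def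
  by (rule cINF_lower) (auto intro: bdd_belowI[of _ 0] simp: sq_norm_H_nonneg)

lemma dist_sq_contraction: "dist_sq Hm (w (Suc k)) solutions + step k \<bullet> (Gm *v step k) \<le> dist_sq Hm (w k) solutions"
  unfolding dist_sq_def[of Hm "w k"]
proof (rule cINF_greatest[OF solutions_nonempty])
  fix v assume "v \<in> solutions"
  then show "dist_sq Hm (w (Suc k)) solutions + step k \<bullet> (Gm *v step k) \<le> sq_norm Hm (w k - v)"
    using dist_sq_H_le[of v "w (Suc k)"] contraction[of v k] by linarith
qed

lemma linear_rate:
  obtains \<epsilon> where "0 < \<epsilon>" "\<And>k. dist_sq Hm (w (Suc k)) solutions \<le> 1 / (1 + \<epsilon>) * dist_sq Hm (w k) solutions"
proof -
  obtain Z where Z: "0 < Z" "\<And>k. \<exists>v\<in>solutions. norm (w (Suc k) - v) \<le> Z * norm (step k)"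
    using error_bound by blast
  obtain \<gamma> where \<gamma>: "0 < \<gamma>" "\<And>z. \<gamma> * (norm z)\<^sup>2 \<le> z \<bullet> (Gm *v z)"
    using positive_definite_lower_bound[of Gm] G_pos by blast
  obtain \<Lambda> where \<Lambda>: "0 < \<Lambda>" "\<And>z. z \<bullet> (Hm *v z) \<le> \<Lambda> * (norm z)\<^sup>2"
    using quadratic_form_upper_bound[of Hm] by blast
  \<comment> \<open>The squared distance after the step is at most \<Lambda> Z^2 times the squared
    step length, while the decrease is at least \<gamma> times it; \<epsilon> is the ratio.\<close>
  define \<epsilon> where "\<epsilon> = \<gamma> / (\<Lambda> * Z\<^sup>2)"
  have "0 < \<epsilon>" using Z(1) \<gamma>(1) \<Lambda>(1) by (simp add: \<epsilon>_def)
  moreover have "dist_sq Hm (w (Suc k)) solutions \<le> 1 / (1 + \<epsilon>) * dist_sq Hm (w k) solutions" for k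
  proof -
    obtain v where v: "v \<in> solutions" "norm (w (Suc k) - v) \<le> Z * norm (step k)" using Z(2) by blast
    have "dist_sq Hm (w (Suc k)) solutions \<le> \<Lambda> * (norm (w (Suc k) - v))\<^sup>2"
      using dist_sq_H_le[OF v(1)] \<Lambda>(2) unfolding sq_norm_def by (rule order_trans)
    also have "\<dots> \<le> \<Lambda> * (Z * norm (step k))\<^sup>2"
      using v(2) \<Lambda>(1) by (intro mult_left_mono power_mono) auto
    finally have "\<epsilon> * dist_sq Hm (w (Suc k)) solutions \<le> \<epsilon> * (\<Lambda> * (Z * norm (step k))\<^sup>2)"
      using \<open>0 < \<epsilon>\<close> by simp
    also have "\<dots> = \<gamma> * (norm (step k))\<^sup>2"
      using Z(1) \<Lambda>(1) by (simp add: \<epsilon>_def power_mult_distrib)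
    also have "\<dots> \<le> step k \<bullet> (Gm *v step k)" by (rule \<gamma>(2))
    finally have "(1 + \<epsilon>) * dist_sq Hm (w (Suc k)) solutions \<le> dist_sq Hm (w k) solutions"
      using dist_sq_contraction[of k] by (simp add: distrib_right)
    then show ?thesis using \<open>0 < \<epsilon>\<close> by (simp add: pos_le_divide_eq mult.commute)
  qed
  ultimately show ?thesis using that by blast
qed

end

theorem theorem2p5:
  fixes bx :: "'m::finite \<Rightarrow> 'p::finite" and bd :: "'d::finite \<Rightarrow> 'q::finite"
    and f :: "'p \<Rightarrow> real ^ 'm \<Rightarrow> real" and g :: "'q \<Rightarrow> real ^ 'd \<Rightarrow> real"
    and A :: "real ^ 'm ^ 'n::finite" and B :: "real ^ 'd ^ 'n" and c :: "real ^ 'n"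
    and X :: "'p \<Rightarrow> (real ^ 'm) set" and Y :: "'q \<Rightarrow> (real ^ 'd) set"
    and \<beta> \<sigma>1 \<sigma>2 \<tau> s :: real
    and w :: "nat \<Rightarrow> real ^ ('m + 'd + 'n)"
  assumes "surj bx" and "surj bd"
    and "\<And>i. closed_proper_convex_on (block_space bx i) (f i)"
    and "\<And>j. closed_proper_convex_on (block_space bd j) (g j)"
    and "\<And>i. X i \<subseteq> block_space bx i" and "\<And>i. polyhedron (X i)"
    and "\<And>j. Y j \<subseteq> block_space bd j" and "\<And>j. polyhedron (Y j)"
    and "\<exists>x y. is_solution bx bd f g A B c X Y x y"
    and "\<And>i. rank (col_block bx i A) = block_dim bx i"
    and "\<And>j. rank (col_block bd j B) = block_dim bd j"
    and "\<beta> > 0" and "\<sigma>1 > real CARD('p) - 1" and "\<sigma>2 > real CARD('q) - 1"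
    and "\<tau> < 1" and "s < 1" and "\<tau> + s > 0"
    and "\<And>i. piecewise_linear_mf (subdiff_on (block_space bx i) (f i))"
    and "\<And>j. piecewise_linear_mf (subdiff_on (block_space bd j) (g j))"
    and "gs_admm bx bd f g A B c X Y \<beta> \<sigma>1 \<sigma>2 \<tau> s w"
  defines "\<delta> \<equiv> delta_const bx bd A B \<beta> \<sigma>1 \<sigma>2 \<tau> s"
    and "H \<equiv> H_mat bx bd A B \<beta> \<sigma>1 \<sigma>2 \<tau> s"
    and "G \<equiv> G_mat bx bd A B \<beta> \<sigma>1 \<sigma>2 \<tau> s"
    and "Mstar \<equiv> M_star bx bd f g A B c X Y"
  shows "\<exists>\<zeta>>0. \<exists>\<epsilon>.
     \<epsilon> = lambda_min G /
         (\<zeta>\<^sup>2 * Max (range (\<lambda>i. \<delta> * gram_max bx i A) \<union> range (\<lambda>j. \<delta> * gram_max bd j B) \<union> {\<delta>})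
            * lambda_max H) \<and>
     \<epsilon> > 0 \<and>
     (\<forall>k. dist_sq H (w (Suc k)) Mstar \<le> 1 / (1 + \<epsilon>) * dist_sq H (w k) Mstar)"
proof -
  interpret gs_admm_run bx bd A B \<beta> \<sigma>1 \<sigma>2 \<tau> s f g c X Y w
    using assms(3-20) by unfold_locales (auto simp: closed_proper_convex_on_def)
  have eqs: "H = Hm" "G = Gm" "Mstar = solutions"
    by (simp_all add: H_def G_def Mstar_def Hm_def Gm_def solutions_def)
  define N where "N = Max (range (\<lambda>i. \<delta> * gram_max bx i A) \<union> range (\<lambda>j. \<delta> * gram_max bd j B) \<union> {\<delta>})"
  have "0 < \<delta>"
    unfolding \<delta>_def using assms(1,2) \<beta> by (rule delta_const_pos)
  also have "\<delta> \<le> N" unfolding N_def by (intro Max_ge) auto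
  finally have "0 < N" .
  have "0 < lambda_min G" by (unfold eqs, intro lambda_min_pos G_symmetric G_pos)
  have "0 < lambda_max H" by (unfold eqs, intro lambda_max_pos H_symmetric H_pos)
  obtain \<epsilon> where \<epsilon>: "0 < \<epsilon>"
    "\<And>k. dist_sq H (w (Suc k)) Mstar \<le> 1 / (1 + \<epsilon>) * dist_sq H (w k) Mstar"
    unfolding eqs using linear_rate by blast
  \<comment> \<open>The prescribed formula solved for \<zeta>; the radicand is positive by the three
    facts just established.\<close>
  define \<zeta> where "\<zeta> = sqrt (lambda_min G / (\<epsilon> * N * lambda_max H))"
  have "0 < \<zeta>"
    using \<open>0 < N\<close> \<open>0 < lambda_min G\<close> \<open>0 < lambda_max H\<close> \<epsilon>(1) by (simp add: \<zeta>_def)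
  moreover have "\<epsilon> = lambda_min G / (\<zeta>\<^sup>2 * N * lambda_max H)"
  proof -
    have \<zeta>2: "\<zeta>\<^sup>2 = lambda_min G / (\<epsilon> * N * lambda_max H)"
      using \<open>0 < N\<close> \<open>0 < lambda_min G\<close> \<open>0 < lambda_max H\<close> \<epsilon>(1) by (simp add: \<zeta>_def)
    show ?thesis
      unfolding \<zeta>2 using \<open>0 < N\<close> \<open>0 < lambda_min G\<close> \<open>0 < lambda_max H\<close> \<epsilon>(1) by simp
  qed
  ultimately show ?thesis
    using \<epsilon>(1) \<epsilon>(2) unfolding N_def by blast
qed

end
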